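(* Let $\lambda/\mu$ be a skew partition, written in Frobenius notation as $\lambda=(\alpha\,|\,\beta)$, $\mu=(\gamma\,|\,\delta)$ with $\alpha=(\alpha_1,\ldots,\alpha_p)$, $\beta=(\beta_1,\ldots,\beta_p)$, $\gamma=(\gamma_1,\ldots,\gamma_q)$, $\delta=(\delta_1,\ldots,\delta_q)$. (1) If $p\ge 2$, then \[ S^{(r)}_{(\alpha|\beta)}(X)\,S^{(r)}_{({}^-\alpha^-|{}^-\beta^-)}(X)=S^{(r)}_{(\alpha^-|\beta^-)}(X)\,S^{(r)}_{({}^-\alpha|{}^-\beta)}(X)-S^{(r)}_{({}^-\alpha|\beta^-)}(X)\,S^{(r)}_{(\alpha^-|{}^-\beta)}(X). \] (2) If $q\ge1$, then \begin{align*} &S^{(r)}_{(\alpha|\beta)/(\gamma|\delta)}(X)\,S^{(r)}_{({}^-\alpha|{}^-\beta)/(\gamma^-|\delta^-)}(X) =S^{(r)}_{(\alpha|\beta)/(\gamma^-|\delta^-)}(X)\,S^{(r)}_{({}^-\alpha|{}^-\beta)/(\gamma|\delta)}(X)\\ &\quad+\sum_{i,j=1}^{p}(-1)^{i+j}h^{(r+\gamma_q+1)}_{\alpha_i-\gamma_q}(X)\,e^{(r-\delta_q-1)}_{\beta_j-\delta_q}(X)\,S^{(r)}_{(\alpha^\vee(i)|{}^-\beta)/(\gamma^-|\delta^-)}(X)\,S^{(r)}_{({}^-\alpha|\beta^\vee(j))/(\gamma^-|\delta^-)}(X). \end{align*}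
   Context: Let $N$ be a positive integer and $X=[x_{i,j}]_{1\le i,j\le N}$ a matrix of indeterminates. Over $\mathbb{C}(X)$ write the Gauss decomposition $X=X_-X_0X_+$ ($X_-$ lower unitriangular, $X_0$ diagonal, $X_+$ upper unitriangular). For $0\le r\le N$ and partitions $\mu\subset\lambda$ contained in $((N-r)^r)$, let $I=\{\mu_{r+1-a}+a:1\le a\le r\}$, $J=\{\lambda_{r+1-a}+a:1\le a\le r\}$, and let $S^{(r)}_{\lambda/\mu}(X)$ be the minor of $X_+$ with row set $I$ and column set $J$; $S^{(r)}_\lambda=S^{(r)}_{\lambda/\varnothing}$. Put $h^{(r)}_d=S^{(r)}_{(d)}$, $e^{(r)}_d=S^{(r)}_{(1^d)}$ for $d\ge0$ and $h^{(r)}_d=e^{(r)}_d=0$ for $d<0$. $N$ is assumed large enough that everything is defined. Frobenius notation: if $\lambda$ has $p$ diagonal boxes, $\lambda=(\alpha\,|\,\beta)$ with $\alpha_i=\lambda_i-i$, $\beta_i=\lambda'_i-i$ ($1\le i\le p$, $\lambda'$ the conjugate); conversely a pair of strictly decreasing tuples of nonnegative integers of equal length determines a partition (the empty tuples give $\varnothing$). For a tuple $\xi=(\xi_1,\ldots,\xi_p)$: ${}^-\xi=(\xi_2,\ldots,\xi_p)$, $\xi^-=(\xi_1,\ldots,\xi_{p-1})$, ${}^-\xi^-=(\xi_2,\ldots,\xi_{p-1})$, and $\xi^\vee(j)=(\xi_1,\ldots,\xi_{j-1},\xi_{j+1},\ldots,\xi_p)$. *)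

theory Defs
  imports
    "HOL-Library.Poly_Mapping"
    "HOL-Library.Product_Lexorder"
    "HOL-Computational_Algebra.Fraction_Field"
    "Jordan_Normal_Form.Determinant"
    "Jordan_Normal_Form.DL_Submatrix"
begin

section \<open>The generic matrix\<close>

text \<open>
  Polynomials over the complex numbers in indeterminates indexed by pairs of natural numbers;
  a monomial is its finitely supported exponent vector. The lexicographic order on pairs
  serves only to obtain the instance of class \<open>idom\<close>. All indeterminates live in one field;
  the matrix of size \<open>N\<close> involves only those with both indices below \<open>N\<close>.
\<close>

type_synonym cpoly = "((nat \<times> nat) \<Rightarrow>\<^sub>0 nat) \<Rightarrow>\<^sub>0 complex"

definition indet :: "nat \<times> nat \<Rightarrow> cpoly" where
  "indet v = Poly_Mapping.single (Poly_Mapping.single v 1) 1"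

text \<open>Rows and columns are numbered from \<open>0\<close>, as always for \<^typ>\<open>'a mat\<close>.\<close>

definition generic_matrix :: "nat \<Rightarrow> cpoly fract mat" where
  "generic_matrix N = mat N N (\<lambda>v. Fract (indet v) 1)"


section \<open>Gauss decomposition\<close>

definition lower_unitriangular :: "'a::zero_neq_one mat \<Rightarrow> bool" where
  "lower_unitriangular A \<longleftrightarrow>
     (\<forall>i<dim_row A. A $$ (i,i) = 1) \<and> (\<forall>i<dim_row A. \<forall>j<dim_col A. i < j \<longrightarrow> A $$ (i,j) = 0)"

definition upper_unitriangular :: "'a::zero_neq_one mat \<Rightarrow> bool" where
  "upper_unitriangular A \<longleftrightarrow> (\<forall>i<dim_row A. A $$ (i,i) = 1) \<and> upper_triangular A"

definition gauss_decomposition ::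
  "nat \<Rightarrow> 'a::field mat \<Rightarrow> 'a mat \<Rightarrow> 'a mat \<Rightarrow> 'a mat \<Rightarrow> bool" where
  "gauss_decomposition n A L D U \<longleftrightarrow>
     L \<in> carrier_mat n n \<and> D \<in> carrier_mat n n \<and> U \<in> carrier_mat n n \<and>
     lower_unitriangular L \<and> diagonal_mat D \<and> upper_unitriangular U \<and> A = L * D * U"

definition gauss_upper :: "'a::field mat \<Rightarrow> 'a mat" where
  "gauss_upper A = (THE U. \<exists>L D. gauss_decomposition (dim_row A) A L D U)"

text \<open>
  The generic matrix has a unique Gauss decomposition, so \<open>gauss_upper\<close> is its upper factor.
  Since a decomposition exists already over the subfield generated by the entries of the matrix,
  uniqueness places its factors in that subfield.
\<close>

lemma gauss_decomposition_entry:
  assumes "gauss_decomposition n A L D U" "i < n" "j < n"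
  shows "A $$ (i,j) = (\<Sum>m<n. L $$ (i,m) * D $$ (m,m) * U $$ (m,j))"
proof -
  have c: "L \<in> carrier_mat n n" "D \<in> carrier_mat n n" "U \<in> carrier_mat n n"
    and d: "diagonal_mat D" and A: "A = L * D * U"
    using assms(1) by (auto simp: gauss_decomposition_def)
  have LD: "(L * D) $$ (i,m) = L $$ (i,m) * D $$ (m,m)" if "m < n" for m
  proof -
    have "(L * D) $$ (i,m) = (\<Sum>k<n. L $$ (i,k) * D $$ (k,m))"
      using c that assms(2) by (auto simp: scalar_prod_def atLeast0LessThan intro!: sum.cong)
    also have "\<dots> = (\<Sum>k<n. if k = m then L $$ (i,m) * D $$ (m,m) else 0)"
      using d c that by (intro sum.cong) (auto simp: diagonal_mat_def)
    finally show ?thesis using that by simp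
  qed
  have "A $$ (i,j) = (\<Sum>m<n. (L * D) $$ (i,m) * U $$ (m,j))"
    unfolding A using c assms(2,3)
    by (auto simp: scalar_prod_def atLeast0LessThan simp del: assoc_mult_mat intro!: sum.cong)
  then show ?thesis using LD by simp
qed

lemma gauss_decomposition_factors:
  assumes "gauss_decomposition n A L D U"
  shows "L \<in> carrier_mat n n" "D \<in> carrier_mat n n" "U \<in> carrier_mat n n" "A \<in> carrier_mat n n"
    "\<And>i. i < n \<Longrightarrow> L $$ (i,i) = 1" "\<And>i. i < n \<Longrightarrow> U $$ (i,i) = 1"
    "\<And>i j. i < j \<Longrightarrow> j < n \<Longrightarrow> L $$ (i,j) = 0" "\<And>i j. j < i \<Longrightarrow> i < n \<Longrightarrow> U $$ (i,j) = 0"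
    "\<And>i j. i < n \<Longrightarrow> j < n \<Longrightarrow> i \<noteq> j \<Longrightarrow> D $$ (i,j) = 0"
  using assms by (auto simp: gauss_decomposition_def lower_unitriangular_def
      upper_unitriangular_def diagonal_mat_def upper_triangular_def)

lemma gauss_decomposition_det:
  assumes "gauss_decomposition n A L D U"
  shows "det A = (\<Prod>i<n. D $$ (i,i))"
proof -
  note f = gauss_decomposition_factors[OF assms]
  have "det L = 1"
    using det_lower_triangular[of n L] f by (simp add: prod_list_diag_prod)
  moreover have "det U = 1"
    using det_upper_triangular[of U n] f by (simp add: prod_list_diag_prod upper_triangular_def)
  moreover have "det D = (\<Prod>i<n. D $$ (i,i))"
    using det_upper_triangular[of D n] f
    by (simp add: prod_list_diag_prod upper_triangular_def atLeast0LessThan)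
  moreover have "A = L * D * U" using assms by (simp add: gauss_decomposition_def)
  ultimately show ?thesis using f by (simp add: det_mult[of _ n])
qed

lemma gauss_decomposition_unique:
  assumes g: "gauss_decomposition n A L D U" and g': "gauss_decomposition n A L' D' U'"
    and "det A \<noteq> 0"
  shows "L = L' \<and> D = D' \<and> U = U'"
proof -
  note f = gauss_decomposition_factors[OF g] and f' = gauss_decomposition_factors[OF g']
  have D0: "D $$ (k,k) \<noteq> 0" if "k < n" for k
    using gauss_decomposition_det[OF g] assms(3) that by simp
  have entry: "D $$ (k,k) = D' $$ (k,k) \<and> (\<forall>i<n. L $$ (i,k) = L' $$ (i,k)) \<and>
      (\<forall>j<n. U $$ (k,j) = U' $$ (k,j))" if "k < n" for k
    using that
  proof (induction k rule: less_induct)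
    case (less k)
    define T where "T i j = (\<Sum>m<k. L $$ (i,m) * D $$ (m,m) * U $$ (m,j))" for i j
    have split: "A $$ (i,j) = T i j + L $$ (i,k) * D $$ (k,k) * U $$ (k,j)"
      "A $$ (i,j) = T i j + L' $$ (i,k) * D' $$ (k,k) * U' $$ (k,j)"
      if "i < n" "j < n" "i = k \<or> j = k" for i j
    proof -
      have "A $$ (i,j) = (\<Sum>m<Suc k. L $$ (i,m) * D $$ (m,m) * U $$ (m,j))"
        unfolding gauss_decomposition_entry[OF g that(1,2)]
        using that less.prems f(7,8) by (intro sum.mono_neutral_right) auto
      then show "A $$ (i,j) = T i j + L $$ (i,k) * D $$ (k,k) * U $$ (k,j)"
        by (simp add: T_def)
      have "A $$ (i,j) = (\<Sum>m<Suc k. L' $$ (i,m) * D' $$ (m,m) * U' $$ (m,j))"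
        unfolding gauss_decomposition_entry[OF g' that(1,2)]
        using that less.prems f'(7,8) by (intro sum.mono_neutral_right) auto
      moreover have "(\<Sum>m<k. L' $$ (i,m) * D' $$ (m,m) * U' $$ (m,j)) = T i j"
        unfolding T_def using less that by (intro sum.cong) auto
      ultimately show "A $$ (i,j) = T i j + L' $$ (i,k) * D' $$ (k,k) * U' $$ (k,j)"
        by simp
    qed
    have D: "D $$ (k,k) = D' $$ (k,k)"
      using split[of k k] less.prems f(5,6) f'(5,6) by simp
    moreover have "L $$ (i,k) = L' $$ (i,k)" if "i < n" for i
      using split[of i k] that less.prems f(5,6) f'(5,6) D D0[of k] by simp
    moreover have "U $$ (k,j) = U' $$ (k,j)" if "j < n" for j
      using split[of k j] that less.prems f(5,6) f'(5,6) D D0[of k] by simp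
    ultimately show ?case by blast
  qed
  have "D $$ (i,j) = D' $$ (i,j)" if "i < n" "j < n" for i j
    using entry f(9) f'(9) that by (cases "i = j") auto
  then show ?thesis
    using entry f(1-3) f'(1-3) by (auto intro!: eq_matI)
qed

lemma det_nonzero_inverse:
  fixes A :: "'a::field mat"
  assumes "A \<in> carrier_mat n n" "det A \<noteq> 0"
  obtains B where "B \<in> carrier_mat n n" "A * B = 1\<^sub>m n" "B * A = 1\<^sub>m n"
  using det_non_zero_imp_unit[OF assms, of "()"] by (auto simp: Units_def ring_mat_def)

lemma gauss_decomposition_exists:
  fixes A :: "'a::field mat"
  assumes "A \<in> carrier_mat n n" "\<And>k. k < n \<Longrightarrow> det (mat k k (\<lambda>v. A $$ v)) \<noteq> 0"
  shows "\<exists>L D U. gauss_decomposition n A L D U"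
  using assms
proof (induction n arbitrary: A)
  case 0
  then have "gauss_decomposition 0 A A A A"
    by (auto simp: gauss_decomposition_def lower_unitriangular_def upper_unitriangular_def
        diagonal_mat_def upper_triangular_def)
  then show ?case by blast
next
  case (Suc n)
  define A' where "A' = mat n n (\<lambda>v. A $$ v)"
  define B where "B = mat n 1 (\<lambda>(i,j). A $$ (i,n))"
  define C where "C = mat 1 n (\<lambda>(i,j). A $$ (n,j))"
  define E where "E = mat 1 1 (\<lambda>_. A $$ (n,n))"
  have car: "A' \<in> carrier_mat n n" "B \<in> carrier_mat n 1" "C \<in> carrier_mat 1 n" "E \<in> carrier_mat 1 1"
    by (simp_all add: A'_def B_def C_def E_def)
  have A: "A = four_block_mat A' B C E"
    using Suc.prems(1) by (intro eq_matI) (auto simp: A'_def B_def C_def E_def less_Suc_eq)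
  have "mat k k (\<lambda>v. A' $$ v) = mat k k (\<lambda>v. A $$ v)" if "k < n" for k
    using that by (intro eq_matI) (auto simp: A'_def)
  then obtain L D U where g: "gauss_decomposition n A' L D U"
    using Suc.IH[of A'] Suc.prems(2) car(1) by (metis less_Suc_eq)
  note f = gauss_decomposition_factors[OF g]
  have A': "A' = L * D * U" using g by (simp add: gauss_decomposition_def)
  have "det A' \<noteq> 0" using Suc.prems(2)[of n] by (simp add: A'_def)
  then have nz: "det (L * D) \<noteq> 0" "det (D * U) \<noteq> 0"
    unfolding A' using f(1-3) by (auto simp: det_mult[of _ n])
  obtain P where P: "P \<in> carrier_mat n n" "(L * D) * P = 1\<^sub>m n"
    using det_nonzero_inverse[OF _ nz(1)] f(1,2) by (metis mult_carrier_mat)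
  obtain Q where Q: "Q \<in> carrier_mat n n" "Q * (D * U) = 1\<^sub>m n"
    using det_nonzero_inverse[OF _ nz(2)] f(2,3) by (metis mult_carrier_mat)
  define u where "u = P * B"
  define l where "l = C * Q"
  have ul: "u \<in> carrier_mat n 1" "l \<in> carrier_mat 1 n"
    using P Q car by (auto simp: u_def l_def)
  have LDu: "L * D * u = B"
    using P car f(1,2) by (simp add: u_def assoc_mult_mat[symmetric, of _ n n _ n _ 1])
  have lDU: "l * D * U = C"
  proof -
    have "l * D * U = l * (D * U)" using ul f by (simp add: assoc_mult_mat)
    also have "\<dots> = C * (Q * (D * U))"
      unfolding l_def using car Q(1) f by (intro assoc_mult_mat) auto
    finally show ?thesis using car Q by simp
  qed
  define s where "s = E - l * D * u"
  have s: "s \<in> carrier_mat 1 1" "l * D * u + s = E"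
    using car ul f by (auto simp: s_def intro!: eq_matI)
  let ?L = "four_block_mat L (0\<^sub>m n 1) l (1\<^sub>m 1)"
  let ?D = "four_block_mat D (0\<^sub>m n 1) (0\<^sub>m 1 n) s"
  let ?U = "four_block_mat U u (0\<^sub>m 1 n) (1\<^sub>m 1)"
  have LD: "?L * ?D = four_block_mat (L * D) (0\<^sub>m n 1) (l * D) s"
    using ul s f by (subst mult_four_block_mat) auto
  have "?L * ?D * ?U = four_block_mat (L * D * U) (L * D * u) (l * D * U) (l * D * u + s)"
    unfolding LD using ul s f by (subst mult_four_block_mat) auto
  then have "A = ?L * ?D * ?U"
    unfolding A LDu lDU s(2) A'[symmetric] by simp
  moreover have "lower_unitriangular ?L" "diagonal_mat ?D" "upper_unitriangular ?U"
    using f ul s by (auto simp: lower_unitriangular_def diagonal_mat_def upper_unitriangular_def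
        upper_triangular_def less_Suc_eq)
  moreover have "?L \<in> carrier_mat (Suc n) (Suc n)" "?D \<in> carrier_mat (Suc n) (Suc n)"
    "?U \<in> carrier_mat (Suc n) (Suc n)"
    using four_block_carrier_mat[of _ n n _ 1 1] f ul s by auto
  ultimately show ?case unfolding gauss_decomposition_def by blast
qed

lemma det_generic_poly_nonzero: "det (mat k k indet) \<noteq> 0"
proof -
  define e :: "(nat \<Rightarrow> nat) \<Rightarrow> (nat \<times> nat \<Rightarrow>\<^sub>0 nat)"
    where "e \<pi> = (\<Sum>i<k. Poly_Mapping.single (i, \<pi> i) 1)" for \<pi>
  have prod: "(\<Prod>i<k. indet (i, \<pi> i)) = Poly_Mapping.single (e \<pi>) 1" for \<pi>
    unfolding e_def indet_def by (induction k) (simp_all add: mult_single add.commute)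
  have lookup_e: "Poly_Mapping.lookup (e \<pi>) (i, i) = (if \<pi> i = i then 1 else 0)" if "i < k" for \<pi> i
  proof -
    have "Poly_Mapping.lookup (e \<pi>) (i, i) = (\<Sum>m<k. if m = i then (if \<pi> i = i then 1 else 0) else 0)"
      unfolding e_def lookup_sum by (intro sum.cong) (auto simp: lookup_single when_def)
    then show ?thesis using that by simp
  qed
  have e_eq: "e \<pi> = e id \<longleftrightarrow> \<pi> = id" if "\<pi> permutes {..<k}" for \<pi>
  proof
    assume "e \<pi> = e id"
    then have "\<pi> i = i" if "i < k" for i
      using lookup_e[OF that, of \<pi>] lookup_e[OF that, of id]
      by (metis id_apply zero_neq_one)
    moreover have "\<pi> i = i" if "\<not> i < k" for i
      using permutes_not_in[OF \<open>\<pi> permutes {..<k}\<close>, of i] that by simp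
    ultimately show "\<pi> = id" by (metis eq_id_iff)
  qed simp
  have "det (mat k k indet) =
      (\<Sum>\<pi> | \<pi> permutes {..<k}. signof \<pi> * Poly_Mapping.single (e \<pi>) 1)"
    unfolding prod[symmetric]
    by (subst det_def'[of _ k])
      (auto simp: atLeast0LessThan permutes_in_image intro!: sum.cong prod.cong
        arg_cong2[where f = "(*)"])
  also have "Poly_Mapping.lookup \<dots> (e id) = (\<Sum>\<pi> | \<pi> permutes {..<k}. if \<pi> = id then 1 else 0)"
    unfolding lookup_sum using e_eq
    by (intro sum.cong) (auto simp: sign_def lookup_single when_def)
  also have "\<dots> = 1" using permutes_id[of "{..<k}"] by (simp add: finite_permutations)
  finally show ?thesis by auto
qed

lemma det_generic_matrix_nonzero: "det (generic_matrix k) \<noteq> 0"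
proof -
  interpret h: comm_ring_hom "\<lambda>x::cpoly. Fract x 1"
    by unfold_locales (simp_all add: One_fract_def[symmetric] Zero_fract_def[symmetric])
  have "generic_matrix k = map_mat (\<lambda>x. Fract x 1) (mat k k indet)"
    by (auto simp: generic_matrix_def)
  then have "det (generic_matrix k) = Fract (det (mat k k indet)) 1"
    by simp
  then show ?thesis
    using det_generic_poly_nonzero[of k] eq_fract(1)[of 1 1 "det (mat k k indet)" 0]
    unfolding Zero_fract_def by simp
qed

theorem gauss_upper_generic_matrix:
  "\<exists>L D. gauss_decomposition N (generic_matrix N) L D (gauss_upper (generic_matrix N))"
proof -
  have d: "dim_row (generic_matrix N) = N" by (simp add: generic_matrix_def)
  have "mat k k (\<lambda>v. generic_matrix N $$ v) = generic_matrix k" if "k < N" for k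
    using that by (auto simp: generic_matrix_def)
  then obtain L D U where g: "gauss_decomposition N (generic_matrix N) L D U"
    using gauss_decomposition_exists[of "generic_matrix N" N] det_generic_matrix_nonzero
    by (auto simp: generic_matrix_def)
  have "gauss_upper (generic_matrix N) = U"
    unfolding gauss_upper_def d
    using g gauss_decomposition_unique[OF g _ det_generic_matrix_nonzero] by blast
  then show ?thesis using g by blast
qed


section \<open>Partitions and Frobenius notation\<close>

text \<open>
  A partition is the function listing its parts, padded with zeros. Indexing starts at \<open>0\<close>:
  \<open>lam i\<close> is the part \<open>\<lambda>\<^sub>i\<^sub>+\<^sub>1\<close>.
\<close>

definition is_partition :: "(nat \<Rightarrow> nat) \<Rightarrow> bool" where
  "is_partition lam \<longleftrightarrow> antimono lam \<and> finite {i. lam i \<noteq> 0}"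

definition empty_partition :: "nat \<Rightarrow> nat" where
  "empty_partition = (\<lambda>_. 0)"

definition row_partition :: "nat \<Rightarrow> nat \<Rightarrow> nat" where
  "row_partition d = (\<lambda>i. if i = 0 then d else 0)"

definition column_partition :: "nat \<Rightarrow> nat \<Rightarrow> nat" where
  "column_partition d = (\<lambda>i. if i < d then 1 else 0)"

text \<open>Containment in the rectangle with \<open>r\<close> rows of length \<open>c\<close>.\<close>

definition in_rectangle :: "nat \<Rightarrow> nat \<Rightarrow> (nat \<Rightarrow> nat) \<Rightarrow> bool" where
  "in_rectangle r c lam \<longleftrightarrow> (\<forall>i. lam i \<le> c) \<and> (\<forall>i\<ge>r. lam i = 0)"

definition conj_partition :: "(nat \<Rightarrow> nat) \<Rightarrow> nat \<Rightarrow> nat" where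
  "conj_partition lam j = card {i. j < lam i}"

definition diagonal_length :: "(nat \<Rightarrow> nat) \<Rightarrow> nat" where
  "diagonal_length lam = card {i. i < lam i}"

definition arms :: "(nat \<Rightarrow> nat) \<Rightarrow> nat list" where
  "arms lam = map (\<lambda>i. lam i - Suc i) [0..<diagonal_length lam]"

definition legs :: "(nat \<Rightarrow> nat) \<Rightarrow> nat list" where
  "legs lam = map (\<lambda>i. conj_partition lam i - Suc i) [0..<diagonal_length lam]"

text \<open>
  The partition \<open>(\<alpha> | \<beta>)\<close>. Below the diagonal, row \<open>i\<close> has one box for each of the columns
  \<open>j\<close> whose leg, which ends in row \<open>j + \<beta>\<^sub>j\<close>, reaches it.
\<close>

definition frobenius :: "nat list \<Rightarrow> nat list \<Rightarrow> nat \<Rightarrow> nat" where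
  "frobenius \<alpha> \<beta> i =
     (if i < length \<alpha> then \<alpha> ! i + Suc i else card {j. j < length \<beta> \<and> i \<le> \<beta> ! j + j})"

text \<open>
  Frobenius notation is a bijection between partitions and pairs of strictly decreasing
  tuples of equal length.
\<close>

lemma is_partition_down_set:
  assumes "is_partition lam"
  shows "{i. j < lam i} = {..<conj_partition lam j}"
proof -
  have "finite {i. lam i \<noteq> 0}" using assms by (simp add: is_partition_def)
  then have fin: "finite {i. j < lam i}" by (rule rev_finite_subset) auto
  have down: "i' \<in> {i. j < lam i}" if "i \<in> {i. j < lam i}" "i' \<le> i" for i i'
    using antimonoD[of lam i' i] assms that by (simp add: is_partition_def)
  show ?thesis
  proof (cases "{i. j < lam i} = {}")
    case True
    then show ?thesis by (simp add: conj_partition_def)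
  next
    case False
    then have "{i. j < lam i} = {..Max {i. j < lam i}}"
      using down[OF Max_in[OF fin]] Max_ge[OF fin] by blast
    then have "{i. j < lam i} = {..<Suc (Max {i. j < lam i})}"
      by (simp add: lessThan_Suc_atMost)
    then show ?thesis unfolding conj_partition_def by (metis card_lessThan)
  qed
qed

lemma less_conj_partition_iff: "is_partition lam \<Longrightarrow> i < conj_partition lam j \<longleftrightarrow> j < lam i"
  using is_partition_down_set by blast

lemma less_diagonal_length_iff:
  assumes "is_partition lam"
  shows "i < diagonal_length lam \<longleftrightarrow> i < lam i"
proof -
  have "finite {i. lam i \<noteq> 0}" using assms by (simp add: is_partition_def)
  then have fin: "finite {i. i < lam i}" by (rule rev_finite_subset) auto
  have down: "i' \<in> {i. i < lam i}" if "i \<in> {i. i < lam i}" "i' \<le> i" for i i'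
    using antimonoD[of lam i' i] assms that by (simp add: is_partition_def)
  have "{i. i < lam i} = {..<diagonal_length lam}"
  proof (cases "{i. i < lam i} = {}")
    case True
    then show ?thesis by (simp add: diagonal_length_def)
  next
    case False
    then have "{i. i < lam i} = {..Max {i. i < lam i}}"
      using down[OF Max_in[OF fin]] Max_ge[OF fin] by blast
    then have "{i. i < lam i} = {..<Suc (Max {i. i < lam i})}"
      by (simp add: lessThan_Suc_atMost)
    then show ?thesis unfolding diagonal_length_def by (metis card_lessThan)
  qed
  then show ?thesis by blast
qed

theorem frobenius_arms_legs:
  assumes "is_partition lam"
  shows "frobenius (arms lam) (legs lam) = lam"
proof
  fix i
  let ?p = "diagonal_length lam"
  note d = less_diagonal_length_iff[OF assms] and c = less_conj_partition_iff[OF assms]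
  show "frobenius (arms lam) (legs lam) i = lam i"
  proof (cases "i < ?p")
    case True
    then show ?thesis using d[of i] by (simp add: frobenius_def arms_def)
  next
    case False
    have "i \<le> legs lam ! j + j \<longleftrightarrow> j < lam i" if "j < ?p" for j
    proof -
      have "j < conj_partition lam j" using c[of j j] d[of j] that by simp
      then have "legs lam ! j + j = conj_partition lam j - 1" using that by (simp add: legs_def)
      then have "i \<le> legs lam ! j + j \<longleftrightarrow> i < conj_partition lam j"
        using \<open>j < conj_partition lam j\<close> by linarith
      then show ?thesis by (simp add: c)
    qed
    moreover have "j < ?p" if "j < lam i" for j
    proof -
      have "\<not> i < lam i" using False d by simp
      then have "j < i" using that by simp
      then have "lam i \<le> lam j" using assms by (simp add: is_partition_def antimono_def)
      then show ?thesis using d that by simp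
    qed
    ultimately have "{j. j < length (legs lam) \<and> i \<le> legs lam ! j + j} = {..<lam i}"
      by (auto simp: legs_def)
    then show ?thesis using False by (simp add: frobenius_def arms_def)
  qed
qed

theorem frobenius_is_partition:
  assumes "sorted_wrt (>) \<alpha>" "sorted_wrt (>) \<beta>" "length \<alpha> = length \<beta>"
  shows "is_partition (frobenius \<alpha> \<beta>)" "arms (frobenius \<alpha> \<beta>) = \<alpha>" "legs (frobenius \<alpha> \<beta>) = \<beta>"
proof -
  let ?f = "frobenius \<alpha> \<beta>" and ?p = "length \<alpha>"
  have \<alpha>: "\<alpha> ! j < \<alpha> ! i" if "i < j" "j < ?p" for i j
    using assms(1) that by (simp add: sorted_wrt_iff_nth_less)
  have \<beta>: "\<beta> ! j < \<beta> ! i" if "i < j" "j < ?p" for i j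
    using assms that by (simp add: sorted_wrt_iff_nth_less)
  have small: "?f i \<le> ?p" if "?p \<le> i" for i
    using card_mono[of "{..<?p}" "{j. j < length \<beta> \<and> i \<le> \<beta> ! j + j}"] that assms(3)
    by (auto simp: frobenius_def)
  have big: "\<alpha> ! i + Suc i \<ge> ?p" if "i < ?p" for i
  proof -
    have "\<alpha> ! (i + k) + k \<le> \<alpha> ! i" if "i + k < ?p" for k
      using that
    proof (induction k)
      case (Suc k)
      then show ?case using \<alpha>[of "i + k" "i + Suc k"] by simp
    qed simp
    from this[of "?p - Suc i"] have "?p - Suc i \<le> \<alpha> ! i" using that by linarith
    then show ?thesis by linarith
  qed
  have mono: "?f (Suc i) \<le> ?f i" for i
  proof (cases "Suc i < ?p")
    case True
    then show ?thesis using \<alpha>[of i "Suc i"] by (simp add: frobenius_def)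
  next
    case False
    show ?thesis
    proof (cases "i < ?p")
      case True
      then show ?thesis using small[of "Suc i"] big[of i] False by (simp add: frobenius_def)
    next
      case F: False
      have "card {j. j < length \<beta> \<and> Suc i \<le> \<beta> ! j + j} \<le> card {j. j < length \<beta> \<and> i \<le> \<beta> ! j + j}"
        by (rule card_mono) auto
      then show ?thesis using F False by (simp add: frobenius_def)
    qed
  qed
  have fin: "finite {i. ?f i \<noteq> 0}"
  proof (rule finite_subset)
    show "{i. ?f i \<noteq> 0} \<subseteq> {..<?p} \<union> (\<Union>j<length \<beta>. {..\<beta> ! j + j})"
      by (auto simp: frobenius_def card_gt_0_iff split: if_splits)
  qed auto
  show part: "is_partition ?f"
    unfolding is_partition_def using fin mono by (simp add: antimono_iff_le_Suc)
  note d = less_diagonal_length_iff[OF part] and c = less_conj_partition_iff[OF part]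
  have "i < diagonal_length ?f \<longleftrightarrow> i < ?p" for i
    unfolding d using small[of i] by (auto simp: frobenius_def)
  then have p: "diagonal_length ?f = ?p" by (metis linorder_neq_iff order_less_irrefl)
  show "arms ?f = \<alpha>"
    unfolding arms_def p by (rule nth_equalityI) (auto simp: frobenius_def)
  have "conj_partition ?f j = \<beta> ! j + Suc j" if "j < ?p" for j
  proof -
    have bb: "\<beta> ! j + j \<le> \<beta> ! i + i" if "i \<le> j" "j < ?p" for i j
      using that
    proof (induction j)
      case (Suc j)
      then show ?case using \<beta>[of j "Suc j"] by (cases "i = Suc j") auto
    qed simp
    have "i < conj_partition ?f j \<longleftrightarrow> i < \<beta> ! j + Suc j" for i
    proof (cases "i < ?p")
      case True
      have "?p - 1 \<le> \<beta> ! (?p - 1) + (?p - 1)" by simp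
      also have "\<dots> \<le> \<beta> ! j + j" using bb[of j "?p - 1"] that by simp
      finally show ?thesis
        unfolding c using True that big[of i] by (auto simp: frobenius_def)
    next
      case False
      let ?J = "{j. j < length \<beta> \<and> i \<le> \<beta> ! j + j}"
      have down: "j' \<in> ?J" if "j \<in> ?J" "j' \<le> j" for j j'
        using bb[of j' j] that assms(3) by auto
      have "j < card ?J \<longleftrightarrow> j \<in> ?J"
      proof
        assume "j \<in> ?J"
        then have "{..j} \<subseteq> ?J" using down by auto
        then have "card {..j} \<le> card ?J" by (intro card_mono) auto
        then show "j < card ?J" by simp
      next
        assume "j < card ?J"
        show "j \<in> ?J"
        proof (rule ccontr)
          assume "j \<notin> ?J"
          then have "?J \<subseteq> {..<j}" using down by (metis (lifting) lessThan_iff linorder_not_le subsetI)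
          then have "card ?J \<le> card {..<j}" by (intro card_mono) auto
          then show False using \<open>j < card ?J\<close> by simp
        qed
      qed
      then show ?thesis
        unfolding c using False that assms(3) by (auto simp: frobenius_def)
    qed
    then show ?thesis by (metis linorder_neq_iff order_less_irrefl)
  qed
  then show "legs ?f = \<beta>"
    unfolding legs_def p using assms(3) by (intro nth_equalityI) auto
qed

text \<open>\<open>omit j \<xi>\<close> removes the entry at position \<open>j\<close>, counted from \<open>0\<close>.\<close>

definition omit :: "nat \<Rightarrow> 'a list \<Rightarrow> 'a list" where
  "omit j \<xi> = take j \<xi> @ drop (Suc j) \<xi>"


section \<open>The minors of the upper factor\<close>

text \<open>
  The set \<open>{\<lambda>\<^bsub>r+1-a\<^esub> + a | 1 \<le> a \<le> r}\<close>, lowered by one because rows and columns are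
  numbered from \<open>0\<close> (with \<open>b = a - 1\<close>).
\<close>

definition index_set :: "nat \<Rightarrow> (nat \<Rightarrow> nat) \<Rightarrow> nat set" where
  "index_set r lam = {lam (r - 1 - b) + b | b. b < r}"

text \<open>
  \<open>skewS X r lam mu\<close> is \<open>S\<^sup>(\<^sup>r\<^sup>)\<^bsub>\<lambda>/\<mu>\<^esub>(X)\<close>. The minor makes sense for any two partitions in the
  rectangle with \<open>r\<close> rows of length \<open>N - r\<close>, and vanishes unless \<open>\<mu>\<close> is contained in \<open>\<lambda>\<close>,
  because the matrix is upper triangular.
\<close>

definition skewS :: "'a::field mat \<Rightarrow> nat \<Rightarrow> (nat \<Rightarrow> nat) \<Rightarrow> (nat \<Rightarrow> nat) \<Rightarrow> 'a" where
  "skewS X r lam mu = det (submatrix (gauss_upper X) (index_set r mu) (index_set r lam))"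

definition straightS :: "'a::field mat \<Rightarrow> nat \<Rightarrow> (nat \<Rightarrow> nat) \<Rightarrow> 'a" where
  "straightS X r lam = skewS X r lam empty_partition"

definition hS :: "'a::field mat \<Rightarrow> nat \<Rightarrow> int \<Rightarrow> 'a" where
  "hS X r d = (if d < 0 then 0 else straightS X r (row_partition (nat d)))"

definition eS :: "'a::field mat \<Rightarrow> nat \<Rightarrow> int \<Rightarrow> 'a" where
  "eS X r d = (if d < 0 then 0 else straightS X r (column_partition (nat d)))"

end

theory Submission imports Defs
begin

text \<open>
  With \<open>A\<close> the upper factor, every function in the theorem is a minor of \<open>A\<close> whose column set is
  \<open>{0..<r}\<close> with the \<open>r - 1 - \<beta>\<^sub>j\<close> replaced by the \<open>r + \<alpha>\<^sub>i\<close>. Part (1) is then a three-term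
  Pluecker relation for the first \<open>r\<close> rows.

  For part (2) let \<open>c = r + \<gamma>\<^sub>q\<close> and \<open>d = r - 1 - \<delta>\<^sub>q\<close>, so that the two row sets are \<open>R \<union> {c}\<close> and
  \<open>R \<union> {d}\<close>, and likewise let \<open>C \<union> {a}\<close> and \<open>C \<union> {b}\<close> be the two column sets. By the Desnanot-Jacobi
  identity the difference of the two products of minors is, up to sign, the product of the minors
  with rows \<open>R \<union> {c, d}\<close>, columns \<open>C \<union> {a, b}\<close> and with rows \<open>R\<close>, columns \<open>C\<close>. The first is expanded
  along row \<open>c\<close>, whose nonzero entries in these columns are values of \<open>h\<close>. In the second,
  the unit column at \<open>d\<close> is a combination of the first \<open>r\<close> columns of \<open>A\<close> with coefficients from the
  inverse of the leading \<open>r \<times> r\<close> block, and these are signed values of \<open>e\<close>.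
\<close>


section \<open>Determinants with listed rows and columns\<close>

text \<open>Rows and columns come as lists, so that order and repetition carry meaning: signs arise
  from swaps, and a repeated index gives 0. The index types are arbitrary, which later allows a sum
  type for adjoined unit columns.\<close>

definition ldet :: "('b \<Rightarrow> 'c \<Rightarrow> 'a::comm_ring_1) \<Rightarrow> 'b list \<Rightarrow> 'c list \<Rightarrow> 'a" where
  "ldet A is js = det (mat (length is) (length is) (\<lambda>(i,j). A (is ! i) (js ! j)))"

lemma length_omit [simp]: "i < length xs \<Longrightarrow> length (omit i xs) = length xs - 1"
  by (simp add: omit_def)

lemma nth_omit: "i < length xs \<Longrightarrow> k < length xs - 1 \<Longrightarrow>
    omit i xs ! k = (if k < i then xs ! k else xs ! Suc k)"
  by (auto simp: omit_def nth_append)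

lemma omit_0 [simp]: "omit 0 (x # xs) = xs"
  by (simp add: omit_def)

lemma omit_Suc [simp]: "omit (Suc i) (x # xs) = x # omit i xs"
  by (simp add: omit_def)

section \<open>Transposition and expansion along a first row or column\<close>

lemma ldet_transpose:
  assumes "length is = length js"
  shows "ldet (\<lambda>j i. A i j) js is = ldet A is js"
proof -
  let ?M = "mat (length is) (length is) (\<lambda>(i,j). A (is ! i) (js ! j))"
  have "mat (length js) (length js) (\<lambda>(j,i). A (is ! i) (js ! j)) = transpose_mat ?M"
    using assms by (intro eq_matI) auto
  then show ?thesis unfolding ldet_def using det_transpose[of ?M "length is"] by simp
qed

lemma ldet_expand_column:
  assumes "length is = Suc (length js)"
  shows "ldet A is (j # js) = (\<Sum>k<length is. (-1) ^ k * A (is ! k) j * ldet A (omit k is) js)"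
proof -
  let ?M = "mat (length is) (length is) (\<lambda>(i,k). A (is ! i) ((j # js) ! k))"
  have "cofactor ?M k 0 = (-1) ^ k * ldet A (omit k is) js" if "k < length is" for k
  proof -
    have "mat_delete ?M k 0 = mat (length (omit k is)) (length (omit k is))
        (\<lambda>(i,m). A (omit k is ! i) (js ! m))"
      using that assms by (intro eq_matI) (auto simp: mat_delete_def nth_omit)
    then show ?thesis by (simp add: cofactor_def ldet_def)
  qed
  then show ?thesis
    unfolding ldet_def[of A "is"]
    using laplace_expansion_column[of ?M "length is" 0] assms by (simp add: mult.assoc mult.left_commute)
qed

lemma ldet_expand_row:
  assumes "length js = Suc (length is)"
  shows "ldet A (i # is) js = (\<Sum>k<length js. (-1) ^ k * A i (js ! k) * ldet A is (omit k js))"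
proof -
  have "ldet A (i # is) js = ldet (\<lambda>j i. A i j) js (i # is)"
    using assms by (intro ldet_transpose[symmetric]) simp
  also have "\<dots> = (\<Sum>k<length js. (-1) ^ k * A i (js ! k) * ldet (\<lambda>j i. A i j) (omit k js) is)"
    using assms by (rule ldet_expand_column)
  also have "\<dots> = (\<Sum>k<length js. (-1) ^ k * A i (js ! k) * ldet A is (omit k js))"
    using assms by (intro sum.cong refl arg_cong2[where f = "(*)"] ldet_transpose) auto
  finally show ?thesis .
qed

lemma ldet_repeated_column:
  assumes "length js = length is" "\<not> distinct js"
  shows "ldet A is js = 0"
proof -
  obtain k l where "k < length is" "l < length is" "k \<noteq> l" "js ! k = js ! l"
    using assms by (auto simp: distinct_conv_nth)
  then show ?thesis unfolding ldet_def
    by (intro det_identical_columns[of _ "length is" k l]) (auto simp: col_def)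
qed

lemma ldet_repeated_row:
  assumes "length js = length is" "\<not> distinct is"
  shows "ldet A is js = 0"
  using ldet_repeated_column[of "is" js "\<lambda>j i. A i j"] assms
    ldet_transpose[of "is" js A] by simp

section \<open>Signs of reordered rows and columns\<close>

lemma ldet_swap_columns:
  assumes "length is = length pre + length post + 2"
  shows "ldet A is (pre @ x # y # post) = - ldet A is (pre @ y # x # post)"
proof -
  let ?n = "length is" and ?k = "length pre"
  let ?M = "mat ?n ?n (\<lambda>(i,j). A (is ! i) ((pre @ y # x # post) ! j))"
  have "mat ?n ?n (\<lambda>(i,j). A (is ! i) ((pre @ x # y # post) ! j)) = swapcols ?k (Suc ?k) ?M"
  proof (rule eq_matI)
    fix i j assume "i < dim_row (swapcols ?k (Suc ?k) ?M)" "j < dim_col (swapcols ?k (Suc ?k) ?M)"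
    then have ij: "i < ?n" "j < ?n" by simp_all
    consider "j < ?k" | "j = ?k" | "j = Suc ?k" | "Suc ?k < j" by linarith
    then show "mat ?n ?n (\<lambda>(i,j). A (is ! i) ((pre @ x # y # post) ! j)) $$ (i,j)
        = swapcols ?k (Suc ?k) ?M $$ (i,j)"
      using ij assms by cases (simp_all add: nth_append nth_Cons')
  qed simp_all
  then show ?thesis unfolding ldet_def
    using det_swapcols[of ?k ?n "Suc ?k" ?M] assms by simp
qed

lemma ldet_swap_rows:
  assumes "length js = length pre + length post + 2"
  shows "ldet A (pre @ x # y # post) js = - ldet A (pre @ y # x # post) js"
  using ldet_swap_columns[OF assms, of "\<lambda>j i. A i j" x y] assms
    ldet_transpose[of "pre @ x # y # post" js A] ldet_transpose[of "pre @ y # x # post" js A] by simp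

text \<open>Each entry smaller than \<open>x\<close> is passed by one swap of neighbours, hence one
  sign per such entry. The prefix is arbitrary because every entry passed joins it in the
  induction.\<close>

lemma ldet_insort_column:
  fixes x :: "'c::linorder"
  assumes "sorted cs" "length is = length pre + length cs + 1"
  shows "ldet A is (pre @ insort x cs) =
    (-1) ^ length (filter (\<lambda>c. c < x) cs) * ldet A is (pre @ x # cs)"
  using assms
proof (induction cs arbitrary: pre)
  case (Cons c cs)
  show ?case
  proof (cases "x \<le> c")
    case True
    then have "filter (\<lambda>c. c < x) (c # cs) = []"
      using Cons.prems(1) by (auto simp: filter_empty_conv)
    then show ?thesis using True by simp
  next
    case False
    then have "ldet A is (pre @ insort x (c # cs)) = ldet A is ((pre @ [c]) @ insort x cs)"
      by simp
    also have "\<dots> = (-1) ^ length (filter (\<lambda>c. c < x) cs) * ldet A is (pre @ c # x # cs)"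
      using Cons by (subst Cons.IH) auto
    also have "ldet A is (pre @ c # x # cs) = - ldet A is (pre @ x # c # cs)"
      using Cons.prems(2) by (intro ldet_swap_columns) simp
    finally show ?thesis using False by simp
  qed
qed simp

lemma length_filter_sorted_list_of_set:
  "finite C \<Longrightarrow> length (filter P (sorted_list_of_set C)) = card {c \<in> C. P c}"
  using distinct_card[of "filter P (sorted_list_of_set C)"] by simp

text \<open>A nonempty \<open>pre\<close> serves to pull out a second column after a first one has
  been moved to the front.\<close>

lemma ldet_insert_column:
  assumes "finite C" "x \<notin> C" "length is = length pre + card C + 1"
  shows "ldet A is (pre @ sorted_list_of_set (insert x C)) =
    (-1) ^ card {c \<in> C. c < x} * ldet A is (pre @ x # sorted_list_of_set C)"
  using ldet_insort_column[of "sorted_list_of_set C" "is" pre A x] assms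
  by (simp add: length_filter_sorted_list_of_set)

lemma ldet_insert_row:
  assumes "finite R" "x \<notin> R" "length js = card R + 1"
  shows "ldet A (sorted_list_of_set (insert x R)) js =
    (-1) ^ card {c \<in> R. c < x} * ldet A (x # sorted_list_of_set R) js"
  using ldet_insert_column[of R x js "[]" "\<lambda>j i. A i j"] assms
    ldet_transpose[of "sorted_list_of_set (insert x R)" js A]
    ldet_transpose[of "x # sorted_list_of_set R" js A] by simp

section \<open>Expansion over a set of columns\<close>

text \<open>A position in the sorted list is the number of smaller elements; this turns signed sums
  over positions into signed sums over the elements of a set.\<close>

lemma omit_nth_sorted_list_of_set:
  assumes "finite K" "m < card K"
  shows "omit m (sorted_list_of_set K) = sorted_list_of_set (K - {sorted_list_of_set K ! m})"
    and "card {x \<in> K. x < sorted_list_of_set K ! m} = m"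
proof -
  let ?xs = "sorted_list_of_set K"
  have s: "sorted_wrt (<) ?xs" by simp
  have xs: "?xs = take m ?xs @ ?xs ! m # drop (Suc m) ?xs"
    using assms by (simp add: id_take_nth_drop[symmetric])
  have s': "sorted_wrt (<) (take m ?xs @ ?xs ! m # drop (Suc m) ?xs)"
    using s xs by simp
  have K: "K = set (take m ?xs @ ?xs ! m # drop (Suc m) ?xs)"
    using assms(1) xs by (metis set_sorted_list_of_set)
  have "set (omit m ?xs) = K - {?xs ! m}"
    using s' by (subst K) (auto simp: omit_def sorted_wrt_append)
  moreover have "sorted_wrt (<) (omit m ?xs)"
    using s' by (auto simp: omit_def sorted_wrt_append)
  ultimately show "omit m ?xs = sorted_list_of_set (K - {?xs ! m})"
    using assms(1) by (metis finite_Diff set_sorted_list_of_set strict_sorted_equal strict_sorted_list_of_set)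
  have "{x \<in> K. x < ?xs ! m} = set (take m ?xs)"
    using s' by (subst K) (auto simp: sorted_wrt_append)
  moreover have "distinct (take m ?xs)" by simp
  ultimately show "card {x \<in> K. x < ?xs ! m} = m"
    using assms(2) by (metis distinct_card length_sorted_list_of_set length_take less_imp_le min_absorb2)
qed

lemma ldet_expand_row_set:
  assumes "finite K" "card K = Suc (length is)"
  shows "ldet A (i # is) (sorted_list_of_set K) =
    (\<Sum>k\<in>K. (-1) ^ card {x \<in> K. x < k} * A i k * ldet A is (sorted_list_of_set (K - {k})))"
proof -
  let ?xs = "sorted_list_of_set K"
  have "bij_betw ((!) ?xs) {..<card K} K"
    using assms by (intro bij_betw_nth) auto
  then have "(\<Sum>k\<in>K. (-1) ^ card {x \<in> K. x < k} * A i k * ldet A is (sorted_list_of_set (K - {k})))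
      = (\<Sum>m<card K. (-1) ^ card {x \<in> K. x < ?xs ! m} * A i (?xs ! m)
          * ldet A is (sorted_list_of_set (K - {?xs ! m})))"
    by (simp add: sum.reindex_bij_betw[symmetric])
  also have "\<dots> = (\<Sum>m<card K. (-1) ^ m * A i (?xs ! m) * ldet A is (omit m ?xs))"
    using assms(1) by (intro sum.cong) (simp_all add: omit_nth_sorted_list_of_set)
  finally show ?thesis using assms by (simp add: ldet_expand_row)
qed

lemma ldet_upper_triangular:
  assumes "length js = length is"
    "\<And>i j. j < i \<Longrightarrow> i < length is \<Longrightarrow> A (is ! i) (js ! j) = 0"
  shows "ldet A is js = (\<Prod>i<length is. A (is ! i) (js ! i))"
  unfolding ldet_def
  by (subst det_upper_triangular[of _ "length is"])
    (use assms in \<open>auto simp: upper_triangular_def prod_list_diag_prod atLeast0LessThan\<close>)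

section \<open>Quadratic relations between minors\<close>

text \<open>
  Substituting \<open>v \<mapsto> ldet A is (w # v # cs)\<close>, which is linear in the column \<open>v\<close>, for the first row
  of the matrix with columns \<open>x # y # z # cs\<close> makes that row a combination of the others.
\<close>

lemma pluecker:
  assumes "length is = length cs + 2"
  shows "ldet A is (w # x # cs) * ldet A is (y # z # cs)
      - ldet A is (w # y # cs) * ldet A is (x # z # cs)
      + ldet A is (w # z # cs) * ldet A is (x # y # cs) = 0"
proof -
  let ?n = "length is"
  define js where "js = x # y # z # cs"
  define coef where "coef k = - ((-1) ^ k * ldet A (omit k is) (w # cs))" for k
  \<comment> \<open>Moving \<open>v\<close> to the front costs the sign in \<open>coef\<close>; the
    coefficients do not depend on \<open>v\<close>.\<close>
  have lin: "ldet A is (w # v # cs) = (\<Sum>k<?n. coef k * A (is ! k) v)" for v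
  proof -
    have "ldet A is (w # v # cs) = - ldet A is (v # w # cs)"
      using ldet_swap_columns[of "is" "[]" cs A w v] assms by simp
    then show ?thesis
      using assms by (simp add: ldet_expand_column coef_def sum_negf mult_ac)
  qed
  \<comment> \<open>\<open>js\<close> has one entry more than \<open>is\<close>, so the alternating
    sum is a combination of determinants of one size larger, each with a repeated row.\<close>
  have "(\<Sum>m<length js. (-1) ^ m * ldet A is (w # js ! m # cs) * ldet A is (omit m js))
      = (\<Sum>m<length js. \<Sum>k<?n. coef k * ((-1) ^ m * A (is ! k) (js ! m) * ldet A is (omit m js)))"
    by (simp add: lin sum_distrib_left sum_distrib_right mult_ac)
  also have "\<dots> = (\<Sum>k<?n. coef k * ldet A (is ! k # is) js)"
    using assms by (subst sum.swap)
      (simp add: js_def ldet_expand_row[of "x # y # z # cs"] sum_distrib_left del: sum.lessThan_Suc)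
  also have "\<dots> = 0"
    using assms by (intro sum.neutral ballI) (simp add: js_def ldet_repeated_row)
  finally have "(\<Sum>m<length js. (-1) ^ m * ldet A is (w # js ! m # cs) * ldet A is (omit m js)) = 0" .
  \<comment> \<open>Terms with \<open>m \<ge> 3\<close> repeat a column of \<open>cs\<close>; only
    those of \<open>x\<close>, \<open>y\<close>, \<open>z\<close> remain.\<close>
  moreover have "ldet A is (w # cs ! m # cs) = 0" if "m < length cs" for m
    using assms that by (intro ldet_repeated_column) auto
  ultimately show ?thesis
    by (simp add: js_def sum.lessThan_Suc_shift algebra_simps del: sum.lessThan_Suc)
qed

text \<open>
  The Pluecker relation with two unit columns, which are the \<open>Inr\<close> columns of \<open>B\<close>.
\<close>

lemma desnanot_jacobi:
  assumes "length is = length js" "distinct (i1 # i2 # is)"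
  shows "ldet A (i1 # i2 # is) (j1 # j2 # js) * ldet A is js
    = ldet A (i1 # is) (j1 # js) * ldet A (i2 # is) (j2 # js)
      - ldet A (i1 # is) (j2 # js) * ldet A (i2 # is) (j1 # js)"
proof -
  define B where "B i c = (case c of Inl j \<Rightarrow> A i j | Inr k \<Rightarrow> if i = k then 1 else 0)" for i and c
  have B: "ldet B ks (map Inl ls) = ldet A ks ls" if "length ls = length ks" for ks ls
    unfolding ldet_def B_def using that by (intro arg_cong[where f = det] eq_matI) auto
  have unit: "ldet B (k # ks) (Inr k # cs) = ldet B ks cs" if "length ks = length cs" "k \<notin> set ks" for k ks cs
  proof -
    have "ks ! n \<noteq> k" if "n < length ks" for n
      using that \<open>k \<notin> set ks\<close> by auto
    then show ?thesis
      using that by (simp add: ldet_expand_column sum.lessThan_Suc_shift B_def del: sum.lessThan_Suc)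
  qed
  have unit2: "ldet B (i1 # i2 # is) (Inr i2 # cs) = - ldet B (i1 # is) cs" if "length cs = Suc (length is)" for cs
    using ldet_swap_rows[of "Inr i2 # cs" "[]" "is" B i1 i2] unit[of "i1 # is" cs i2]
      that assms by auto
  \<comment> \<open>The unit columns of \<open>i1\<close> and \<open>i2\<close> take the places of
    \<open>w\<close> and \<open>x\<close>: the six determinants lose both of these rows, one of them
    or none.\<close>
  have "ldet B (i1 # i2 # is) (Inr i1 # Inr i2 # map Inl js) * ldet B (i1 # i2 # is) (Inl j1 # Inl j2 # map Inl js)
      - ldet B (i1 # i2 # is) (Inr i1 # Inl j1 # map Inl js) * ldet B (i1 # i2 # is) (Inr i2 # Inl j2 # map Inl js)
      + ldet B (i1 # i2 # is) (Inr i1 # Inl j2 # map Inl js) * ldet B (i1 # i2 # is) (Inr i2 # Inl j1 # map Inl js) = 0"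
    by (rule pluecker) (use assms in simp)
  moreover note B[of "j1 # j2 # js" "i1 # i2 # is"] B[of "j1 # js"] B[of "j2 # js"] B[of js "is"]
  ultimately show ?thesis
    using assms by (simp add: unit unit2 algebra_simps)
qed

definition minor :: "('b::linorder \<Rightarrow> 'c::linorder \<Rightarrow> 'a::comm_ring_1) \<Rightarrow> 'b set \<Rightarrow> 'c set \<Rightarrow> 'a" where
  "minor A I J = ldet A (sorted_list_of_set I) (sorted_list_of_set J)"

text \<open>In each of the three products all of \<open>w\<close>, \<open>x\<close>,
  \<open>y\<close>, \<open>z\<close> are inserted into \<open>C\<close> once, so the insertion signs
  form one common factor of the relation for lists.\<close>

lemma minor_pluecker:
  fixes A :: "'b::linorder \<Rightarrow> 'c::linorder \<Rightarrow> 'a::comm_ring_1"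
  assumes "finite C" "card I = card C + 2"
    and ord: "w < x" "x < y" "y < z" and C: "w \<notin> C" "x \<notin> C" "y \<notin> C" "z \<notin> C"
  shows "minor A I (insert y (insert z C)) * minor A I (insert w (insert x C))
    = minor A I (insert w (insert y C)) * minor A I (insert x (insert z C))
      - minor A I (insert w (insert z C)) * minor A I (insert x (insert y C))"
proof -
  let ?is = "sorted_list_of_set I" and ?cs = "sorted_list_of_set C"
  define s where "s u = ((-1) ^ card {c \<in> C. c < u} :: 'a)" for u
  have m: "minor A I (insert u (insert v C)) = s u * s v * ldet A ?is (u # v # ?cs)"
    if "u < v" "u \<notin> C" "v \<notin> C" for u v
  proof -
    \<comment> \<open>As \<open>u < v\<close>, the presence of \<open>v\<close> does not alter the
      sign of \<open>u\<close>; the smaller column is pulled out first.\<close>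
    have "{c \<in> insert v C. c < u} = {c \<in> C. c < u}" using that by auto
    then have "minor A I (insert u (insert v C)) = s u * ldet A ?is ([u] @ sorted_list_of_set (insert v C))"
      unfolding minor_def s_def
      using ldet_insert_column[of "insert v C" u ?is "[]" A] assms(1,2) that by simp
    also have "\<dots> = s u * (s v * ldet A ?is ([u] @ v # ?cs))"
      unfolding s_def using assms(1,2) that by (subst ldet_insert_column) auto
    finally show ?thesis by simp
  qed
  have "ldet A ?is (w # x # ?cs) * ldet A ?is (y # z # ?cs)
      = ldet A ?is (w # y # ?cs) * ldet A ?is (x # z # ?cs)
      - ldet A ?is (w # z # ?cs) * ldet A ?is (x # y # ?cs)"
    using pluecker[of ?is ?cs A w x y z] assms(1,2) by (simp add: algebra_simps)
  then have "s w * s x * s y * s z * (ldet A ?is (w # x # ?cs) * ldet A ?is (y # z # ?cs))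
      = s w * s x * s y * s z * (ldet A ?is (w # y # ?cs) * ldet A ?is (x # z # ?cs)
      - ldet A ?is (w # z # ?cs) * ldet A ?is (x # y # ?cs))" by simp
  then show ?thesis
    using ord C by (simp add: m algebra_simps)
qed

text \<open>On the rows \<open>d # is\<close>, the columns in \<open>B\<close> combine with weights
  \<open>g\<close> to the unit column of \<open>d\<close>. A determinant with that first column is
  the one without row \<open>d\<close>, and linearity in the first column gives the sum.\<close>

lemma ldet_unit_column_combination:
  assumes "finite B" "length is = length cs" "d \<notin> set is"
    and "\<And>m. m \<in> insert d (set is) \<Longrightarrow> (\<Sum>b\<in>B. A m b * g b) = (if m = d then 1 else 0)"
  shows "(\<Sum>b\<in>B. g b * ldet A (d # is) (b # cs)) = ldet A is cs"
proof -
  let ?is = "d # is"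
  have "(\<Sum>b\<in>B. g b * ldet A ?is (b # cs))
      = (\<Sum>b\<in>B. \<Sum>k<length ?is. (-1) ^ k * ldet A (omit k ?is) cs * (A (?is ! k) b * g b))"
    using assms(2) by (simp add: ldet_expand_column sum_distrib_left mult_ac del: sum.lessThan_Suc)
  also have "\<dots> = (\<Sum>k<length ?is. (-1) ^ k * ldet A (omit k ?is) cs * (\<Sum>b\<in>B. A (?is ! k) b * g b))"
    by (subst sum.swap) (simp add: sum_distrib_left)
  also have "\<dots> = (\<Sum>k<length ?is. (-1) ^ k * ldet A (omit k ?is) cs * (if ?is ! k = d then 1 else 0))"
  proof (intro sum.cong refl arg_cong2[where f = "(*)"])
    fix k assume "k \<in> {..<length ?is}"
    then have "?is ! k \<in> insert d (set is)" using nth_mem[of k ?is] by simp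
    then show "(\<Sum>b\<in>B. A (?is ! k) b * g b) = (if ?is ! k = d then 1 else 0)"
      by (rule assms(4))
  qed
  also have "\<dots> = ldet A is cs"
  proof -
    have "is ! k \<noteq> d" if "k < length is" for k using that assms(3) by auto
    then show ?thesis by (simp add: sum.lessThan_Suc_shift del: sum.lessThan_Suc)
  qed
  finally show ?thesis .
qed


section \<open>Index sets in Frobenius notation\<close>

text \<open>The beads of the Maya diagram of \<open>(\<alpha> | \<beta>)\<close>, cut off at 0: legs
  mark the positions vacated below \<open>r\<close>, arms those filled from \<open>r\<close> on.
  Legs are meant to be below \<open>r\<close>, where the subtraction on natural numbers is
  exact.\<close>

definition frobenius_set :: "nat \<Rightarrow> nat list \<Rightarrow> nat list \<Rightarrow> nat set" where
  "frobenius_set r \<alpha> \<beta> = ({..<r} - (\<lambda>x. r - 1 - x) ` set \<beta>) \<union> (\<lambda>x. r + x) ` set \<alpha>"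

lemma finite_frobenius_set [simp]: "finite (frobenius_set r \<alpha> \<beta>)"
  by (simp add: frobenius_set_def)

lemma set_eq_nth_image: "set xs = (!) xs ` {..<length xs}"
  by (auto simp: in_set_conv_nth)

lemma sorted_wrt_greater_distinct: "sorted_wrt (>) (xs :: nat list) \<Longrightarrow> distinct xs"
  by (induction xs) auto

text \<open>The first \<open>p\<close> parts reach the diagonal and give the arms. The remaining
  parts give numbers below \<open>r\<close> that avoid the positions of the legs; these are
  \<open>r - p\<close> distinct numbers, as many as there is room for, so counting replaces an
  explicit inverse.\<close>

lemma index_set_frobenius:
  assumes "sorted_wrt (>) \<alpha>" "sorted_wrt (>) \<beta>" "length \<alpha> = length \<beta>" "\<And>x. x \<in> set \<beta> \<Longrightarrow> x < r"
  shows "index_set r (frobenius \<alpha> \<beta>) = frobenius_set r \<alpha> \<beta>"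
proof -
  define lam where "lam = frobenius \<alpha> \<beta>"
  let ?p = "length \<alpha>"
  note part = frobenius_is_partition[OF assms(1-3), folded lam_def]
  note d = less_diagonal_length_iff[OF part(1)] and c = less_conj_partition_iff[OF part(1)]
  have p: "diagonal_length lam = ?p"
    using part(2) by (metis arms_def length_map length_upt minus_nat.diff_0)
  have \<alpha>: "\<alpha> ! i + Suc i = lam i" if "i < ?p" for i
    using that d[of i] p by (subst part(2)[symmetric]) (simp add: arms_def)
  have \<beta>: "\<beta> ! j + Suc j = conj_partition lam j" if "j < ?p" for j
    using that d[of j] c[of j j] p by (subst part(3)[symmetric]) (simp add: legs_def)
  \<comment> \<open>If there is a box at all, the first column has length
    \<open>\<beta> ! 0 + 1\<close>, at most \<open>r\<close>, so no part is left from row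
    \<open>r\<close> on.\<close>
  have lam0: "lam i = 0" if "r \<le> i" for i
  proof (rule ccontr)
    assume "lam i \<noteq> 0"
    then have i: "i < conj_partition lam 0" by (simp add: c)
    then have "0 < conj_partition lam 0" by linarith
    then have "0 < ?p" using d[of 0] p by (simp add: c)
    then have "conj_partition lam 0 \<le> r"
      using \<beta>[of 0] assms(3) assms(4)[of "\<beta> ! 0"] by simp
    then show False using i that by linarith
  qed
  have pr: "i < r" if "i < ?p" for i
  proof (rule ccontr)
    assume "\<not> i < r"
    then have "lam i = 0" by (intro lam0) simp
    then show False using \<alpha>[OF that] by simp
  qed
  have conj_le: "conj_partition lam j \<le> r" for j
    using c[of r j] lam0[OF le_refl] by simp
  \<comment> \<open>\<open>index_set\<close> runs through the parts from the last to the first;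
    \<open>f\<close> takes them in their own order.\<close>
  define f where "f i = lam i + (r - 1 - i)" for i
  have "index_set r lam = f ` {..<r}"
  proof
    show "index_set r lam \<subseteq> f ` {..<r}"
    proof
      fix x assume "x \<in> index_set r lam"
      then obtain b where "b < r" "x = lam (r - 1 - b) + b" by (auto simp: index_set_def)
      then have "x = f (r - 1 - b)" "r - 1 - b \<in> {..<r}" by (simp_all add: f_def)
      then show "x \<in> f ` {..<r}" by blast
    qed
    show "f ` {..<r} \<subseteq> index_set r lam"
    proof clarify
      fix i assume "i < r"
      then have "f i = lam (r - 1 - (r - 1 - i)) + (r - 1 - i)" "r - 1 - i < r"
        by (auto simp: f_def)
      then show "f i \<in> index_set r lam" unfolding index_set_def by blast
    qed
  qed
  also have "{..<r} = {..<?p} \<union> {?p..<r}" using pr by (auto simp: not_less)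
  also have "f ` \<dots> = f ` {..<?p} \<union> f ` {?p..<r}" by (rule image_Un)
  also have "f ` {..<?p} = (\<lambda>x. r + x) ` set \<alpha>"
    unfolding set_eq_nth_image[of \<alpha>] image_image
  proof (rule image_cong[OF refl])
    fix i assume "i \<in> {..<?p}"
    then show "f i = r + \<alpha> ! i" using \<alpha>[of i] pr[of i] by (simp add: f_def)
  qed
  also have "f ` {?p..<r} = {..<r} - (\<lambda>x. r - 1 - x) ` set \<beta>"
  proof (rule card_subset_eq)
    show "f ` {?p..<r} \<subseteq> {..<r} - (\<lambda>x. r - 1 - x) ` set \<beta>"
    proof clarify
      fix i assume i: "i \<in> {?p..<r}"
      then have "lam i \<le> i" using d[of i] p by simp
      then have "f i < r" using i by (auto simp: f_def)
      \<comment> \<open>If the box \<open>(i,j)\<close> lies in the diagram, \<open>f i\<close>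
        exceeds the position of leg \<open>j\<close>; otherwise it falls short of it.\<close>
      moreover have "f i \<noteq> r - 1 - \<beta> ! j" if j: "j < ?p" for j
        using i \<beta>[OF j] conj_le[of j] c[of i j] by (cases "j < lam i") (auto simp: f_def)
      ultimately show "f i \<in> {..<r} - (\<lambda>x. r - 1 - x) ` set \<beta>"
        using assms(3) by (auto simp: set_eq_nth_image[of \<beta>])
    qed
    have "inj_on f {?p..<r}"
    proof (rule linorder_inj_onI')
      fix i j assume "i \<in> {?p..<r}" "j \<in> {?p..<r}" "i < j"
      moreover have "lam j \<le> lam i"
        using part(1) \<open>i < j\<close> by (simp add: is_partition_def antimono_def)
      ultimately show "f i \<noteq> f j" by (auto simp: f_def)
    qed
    then have "card (f ` {?p..<r}) = r - ?p" by (simp add: card_image)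
    moreover have "card ((\<lambda>x. r - 1 - x) ` set \<beta>) = ?p"
      using assms(3) sorted_wrt_greater_distinct[OF assms(2)]
      by (subst card_image) (auto simp: distinct_card inj_on_def dest!: assms(4))
    moreover have "(\<lambda>x. r - 1 - x) ` set \<beta> \<subseteq> {..<r}" by (auto dest!: assms(4))
    ultimately show "card (f ` {?p..<r}) = card ({..<r} - (\<lambda>x. r - 1 - x) ` set \<beta>)"
      by (simp add: card_Diff_subset)
  qed simp
  finally show ?thesis unfolding lam_def[symmetric] by (auto simp: frobenius_set_def)
qed

lemma card_frobenius_set:
  assumes "distinct \<alpha>" "distinct \<beta>" "length \<alpha> = length \<beta>" "\<And>x. x \<in> set \<beta> \<Longrightarrow> x < r"
  shows "card (frobenius_set r \<alpha> \<beta>) = r"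
proof -
  have \<beta>: "card ((\<lambda>x. r - 1 - x) ` set \<beta>) = length \<beta>"
    using assms(2) by (subst card_image) (auto simp: distinct_card inj_on_def dest!: assms(4))
  have sub: "(\<lambda>x. r - 1 - x) ` set \<beta> \<subseteq> {..<r}" by (auto dest!: assms(4))
  then have "length \<beta> \<le> r" using card_mono[OF _ sub] \<beta> by simp
  moreover have "card ((\<lambda>x. r + x) ` set \<alpha>) = length \<alpha>"
    using assms(1) by (subst card_image) (auto simp: distinct_card)
  moreover have "({..<r} - (\<lambda>x. r - 1 - x) ` set \<beta>) \<inter> (\<lambda>x. r + x) ` set \<alpha> = {}" by auto
  ultimately show ?thesis
    using \<beta> sub assms(3) by (simp add: frobenius_set_def card_Un_disjoint card_Diff_subset)
qed

section \<open>Omitting arms and legs\<close>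

lemma set_omit_subset: "set (omit i xs) \<subseteq> set xs"
  unfolding omit_def using set_take_subset[of i xs] set_drop_subset[of "Suc i" xs] by auto

lemma set_omit:
  assumes "distinct xs" "i < length xs"
  shows "set (omit i xs) = set xs - {xs ! i}"
proof -
  have "distinct (take i xs @ xs ! i # drop (Suc i) xs)"
    "set xs = set (take i xs @ xs ! i # drop (Suc i) xs)"
    using assms by (simp_all add: id_take_nth_drop[symmetric])
  then have "xs ! i \<notin> set (omit i xs)" "set xs = insert (xs ! i) (set (omit i xs))"
    unfolding omit_def by auto
  then show ?thesis by blast
qed

lemma sorted_wrt_omit: "sorted_wrt P xs \<Longrightarrow> sorted_wrt P (omit i xs)"
proof (induction xs arbitrary: i)
  case (Cons x xs)
  then show ?case using set_omit_subset by (cases i) fastforce+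
qed (simp add: omit_def)

lemma tl_eq_omit: "xs \<noteq> [] \<Longrightarrow> tl xs = omit 0 xs"
  by (cases xs) auto

lemma butlast_eq_omit: "xs \<noteq> [] \<Longrightarrow> butlast xs = omit (length xs - 1) xs"
  by (simp add: omit_def butlast_conv_take)

text \<open>Dropping an arm frees its column, and dropping a leg restores the column that it had
  removed. \<open>tl\<close> and \<open>butlast\<close> are covered as omissions of the first and
  the last entry.\<close>

lemma frobenius_set_omit:
  assumes "distinct \<alpha>" "distinct \<beta>" "\<And>x. x \<in> set \<beta> \<Longrightarrow> x < r" "i < length \<alpha>" "j < length \<beta>"
  shows "frobenius_set r (omit i \<alpha>) (omit j \<beta>)
    = insert (r - 1 - \<beta> ! j) (frobenius_set r \<alpha> \<beta> - {r + \<alpha> ! i})"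
proof -
  have "(\<lambda>x. r - 1 - x) ` (set \<beta> - {\<beta> ! j}) = (\<lambda>x. r - 1 - x) ` set \<beta> - {r - 1 - \<beta> ! j}"
    using assms(5) by (subst inj_on_image_set_diff[of _ "set \<beta>"]) (auto simp: inj_on_def dest!: assms(3))
  moreover have "(\<lambda>x. r + x) ` (set \<alpha> - {\<alpha> ! i}) = (\<lambda>x. r + x) ` set \<alpha> - {r + \<alpha> ! i}"
    by (subst image_set_diff) auto
  moreover have "r - 1 - \<beta> ! j < r" using assms(3)[of "\<beta> ! j"] assms(5) by simp
  ultimately show ?thesis
    using assms by (auto simp: frobenius_set_def set_omit)
qed

lemma leg_notin_frobenius_set:
  assumes "\<And>x. x \<in> set \<beta> \<Longrightarrow> x < r" "j < length \<beta>"
  shows "r - 1 - \<beta> ! j \<notin> frobenius_set r \<alpha> \<beta>" "r - 1 - \<beta> ! j < r"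
  using assms(1)[of "\<beta> ! j"] assms(2) by (auto simp: frobenius_set_def)

lemma arm_in_frobenius_set: "i < length \<alpha> \<Longrightarrow> r + \<alpha> ! i \<in> frobenius_set r \<alpha> \<beta>"
  by (simp add: frobenius_set_def)

section \<open>Number of columns below a leg or an arm\<close>

text \<open>Below the position of leg \<open>j\<close> exactly the \<open>j\<close> earlier, longer
  legs have left gaps. The parity of the count is an insertion sign.\<close>

lemma card_below_leg:
  assumes "sorted_wrt (>) \<beta>" "\<And>x. x \<in> set \<beta> \<Longrightarrow> x < r" "j < length \<beta>"
  shows "card {x \<in> frobenius_set r \<alpha> \<beta>. x < r - 1 - \<beta> ! j} + j = r - 1 - \<beta> ! j"
proof -
  let ?b = "\<lambda>j. r - 1 - \<beta> ! j"
  have mono: "?b i < ?b k" if "i < k" "k < length \<beta>" for i k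
    using sorted_wrt_nth_less[OF assms(1) that] assms(2)[of "\<beta> ! i"] that by simp
  have ge: "?b j \<le> ?b k" if "j \<le> k" "k < length \<beta>" for k
    using mono[of j k] that by (cases "j = k") auto
  have b: "?b j < r" by (rule leg_notin_frobenius_set[OF assms(2,3)])
  have "x \<in> frobenius_set r \<alpha> \<beta> \<longleftrightarrow> x \<notin> ?b ` {..<j}" if x: "x < ?b j" for x
  proof -
    have "x \<in> (\<lambda>x. r - 1 - x) ` set \<beta> \<longleftrightarrow> x \<in> ?b ` {..<j}"
    proof
      assume "x \<in> (\<lambda>x. r - 1 - x) ` set \<beta>"
      then obtain k where k: "k < length \<beta>" "x = ?b k" by (auto simp: in_set_conv_nth)
      then have "\<not> j \<le> k" using ge[of k] x by linarith
      then show "x \<in> ?b ` {..<j}" using k by auto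
    next
      assume "x \<in> ?b ` {..<j}"
      then obtain k where "k < j" "x = ?b k" by blast
      then show "x \<in> (\<lambda>x. r - 1 - x) ` set \<beta>" using assms(3) by auto
    qed
    moreover have "x < r" using x b by linarith
    ultimately show ?thesis by (auto simp: frobenius_set_def)
  qed
  then have "{x \<in> frobenius_set r \<alpha> \<beta>. x < ?b j} = {..<?b j} - ?b ` {..<j}" by blast
  moreover have sub: "?b ` {..<j} \<subseteq> {..<?b j}" using mono[of _ j] assms(3) by blast
  moreover have "card (?b ` {..<j}) = j"
  proof -
    have "inj_on ?b {..<j}"
    proof (rule linorder_inj_onI')
      fix i k assume "i \<in> {..<j}" "k \<in> {..<j}" "i < k"
      then show "?b i \<noteq> ?b k" using mono[of i k] assms(3) by simp
    qed
    then show ?thesis by (simp add: card_image)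
  qed
  moreover have "j \<le> ?b j" using card_mono[OF _ sub] calculation(3) by simp
  ultimately show ?thesis by (simp add: card_Diff_subset)
qed

text \<open>The columns not below arm \<open>i\<close> are those of the arms \<open>0\<close> to
  \<open>i\<close>, since arms decrease; the whole set has \<open>r\<close> elements.\<close>

lemma card_below_arm:
  assumes "sorted_wrt (>) \<alpha>" "sorted_wrt (>) \<beta>" "length \<alpha> = length \<beta>"
    "\<And>x. x \<in> set \<beta> \<Longrightarrow> x < r" "i < length \<alpha>"
  shows "card {x \<in> frobenius_set r \<alpha> \<beta>. x < r + \<alpha> ! i} + Suc i = r"
proof -
  let ?F = "frobenius_set r \<alpha> \<beta>"
  have mono: "\<alpha> ! k < \<alpha> ! i" if "i < k" "k < length \<alpha>" for i k
    using sorted_wrt_nth_less[OF assms(1) that] by simp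
  have le: "\<alpha> ! i \<le> \<alpha> ! k \<longleftrightarrow> k \<le> i" if "k < length \<alpha>" for k
    using mono[of i k] mono[of k i] that assms(5) by (cases k i rule: linorder_cases) auto
  have F: "x \<in> ?F \<longleftrightarrow> (\<exists>k<length \<alpha>. x = r + \<alpha> ! k)" if "\<not> x < r" for x
    using that by (auto simp: frobenius_set_def set_eq_nth_image[of \<alpha>])
  have "{x \<in> ?F. \<not> x < r + \<alpha> ! i} = (\<lambda>k. r + \<alpha> ! k) ` {..i}"
  proof (intro Set.set_eqI iffI)
    fix x assume "x \<in> {x \<in> ?F. \<not> x < r + \<alpha> ! i}"
    then obtain k where k: "k < length \<alpha>" "x = r + \<alpha> ! k" "\<alpha> ! i \<le> \<alpha> ! k"
      using F[of x] by auto
    then show "x \<in> (\<lambda>k. r + \<alpha> ! k) ` {..i}" using le by auto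
  next
    fix x assume "x \<in> (\<lambda>k. r + \<alpha> ! k) ` {..i}"
    then obtain k where k: "k \<le> i" "x = r + \<alpha> ! k" by auto
    then have "k < length \<alpha>" "\<alpha> ! i \<le> \<alpha> ! k" using assms(5) le[of k] by auto
    then show "x \<in> {x \<in> ?F. \<not> x < r + \<alpha> ! i}" using F[of x] k by auto
  qed
  moreover have "inj_on (\<lambda>k. r + \<alpha> ! k) {..i}"
    using assms(5) sorted_wrt_greater_distinct[OF assms(1)] by (auto simp: inj_on_def nth_eq_iff_index_eq)
  ultimately have "card {x \<in> ?F. \<not> x < r + \<alpha> ! i} = Suc i" by (simp add: card_image)
  moreover have "card {x \<in> ?F. x < r + \<alpha> ! i} + card {x \<in> ?F. \<not> x < r + \<alpha> ! i} = card ?F"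
    by (subst card_Un_disjoint[symmetric]) (auto intro!: arg_cong[where f = card])
  moreover have "card ?F = r"
    using assms sorted_wrt_greater_distinct by (intro card_frobenius_set) auto
  ultimately show ?thesis by simp
qed


section \<open>Recurrences for minors\<close>

text \<open>All six column sets consist of the common set \<open>C\<close> and two of the four
  columns of the first and last arm and leg, so this is one three-term Pluecker relation.\<close>

lemma minor_giambelli_recurrence:
  fixes A :: "nat \<Rightarrow> nat \<Rightarrow> 'a::comm_ring_1"
  assumes dec: "sorted_wrt (>) \<alpha>" "sorted_wrt (>) \<beta>" and len: "length \<alpha> = length \<beta>" "length \<alpha> \<ge> 2"
    and bd: "\<And>x. x \<in> set \<beta> \<Longrightarrow> x < r" and I: "card I = r"
  shows "minor A I (frobenius_set r \<alpha> \<beta>) * minor A I (frobenius_set r (tl (butlast \<alpha>)) (tl (butlast \<beta>)))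
    = minor A I (frobenius_set r (butlast \<alpha>) (butlast \<beta>)) * minor A I (frobenius_set r (tl \<alpha>) (tl \<beta>))
      - minor A I (frobenius_set r (tl \<alpha>) (butlast \<beta>)) * minor A I (frobenius_set r (butlast \<alpha>) (tl \<beta>))"
proof -
  define m where "m = length \<alpha> - 1"
  let ?F = "frobenius_set r \<alpha> \<beta>"
  define a b where "a i = r + \<alpha> ! i" and "b j = r - 1 - \<beta> ! j" for i j
  have m: "0 < m" "m < length \<alpha>" "m < length \<beta>" using len by (auto simp: m_def)
  have ne: "\<alpha> \<noteq> []" "\<beta> \<noteq> []" "butlast \<alpha> \<noteq> []" "butlast \<beta> \<noteq> []"
    using len by (auto simp flip: length_greater_0_conv)
  note dist = sorted_wrt_greater_distinct[OF dec(1)] sorted_wrt_greater_distinct[OF dec(2)]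
  have bd': "x < r" if "x \<in> set (butlast \<beta>)" for x
    using bd that by (auto dest: in_set_butlastD)
  note tls = tl_eq_omit[OF ne(1)] tl_eq_omit[OF ne(2)] butlast_eq_omit[OF ne(1), folded m_def]
    butlast_eq_omit[OF ne(2), folded len(1), folded m_def]
  \<comment> \<open>The tuples have at least two entries, so first and last differ; the first leg
    gives the smallest column, the first arm the largest.\<close>
  have ord: "b 0 < b m" "b m < a m" "a m < a 0"
    using m sorted_wrt_nth_less[OF dec(1), of 0 m] sorted_wrt_nth_less[OF dec(2), of 0 m]
      bd[OF nth_mem, of 0] bd[OF nth_mem, of m] ne by (auto simp: a_def b_def)
  define C where "C = ?F - {a 0, a m}"
  have aF: "a 0 \<in> ?F" "a m \<in> ?F" using m by (auto simp: a_def intro!: arm_in_frobenius_set)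
  have bF: "b 0 \<notin> ?F" "b m \<notin> ?F"
    unfolding b_def using leg_notin_frobenius_set(1)[of \<beta> r 0 \<alpha>, OF bd]
      leg_notin_frobenius_set(1)[of \<beta> r m \<alpha>, OF bd] m ne by auto
  have F: "?F = insert (a m) (insert (a 0) C)" using aF by (auto simp: C_def)
  have omit: "frobenius_set r (omit i \<alpha>) (omit j \<beta>) = insert (b j) (?F - {a i})"
    if "i < length \<alpha>" "j < length \<beta>" for i j
    unfolding a_def b_def using that dist bd by (intro frobenius_set_omit)
  have "frobenius_set r (tl (butlast \<alpha>)) (tl (butlast \<beta>))
      = insert (b 0) (frobenius_set r (butlast \<alpha>) (butlast \<beta>) - {a 0})"
    using frobenius_set_omit[of "butlast \<alpha>" "butlast \<beta>" r 0 0] dist bd' ne m len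
    by (simp add: tl_eq_omit distinct_butlast nth_butlast a_def b_def)
  also have "\<dots> = insert (b 0) (insert (b m) C)"
    unfolding tls(3,4) using ord m by (auto simp: omit C_def)
  finally have mid: "frobenius_set r (tl (butlast \<alpha>)) (tl (butlast \<beta>)) = insert (b 0) (insert (b m) C)" .
  have sets: "frobenius_set r (butlast \<alpha>) (butlast \<beta>) = insert (b m) (insert (a 0) C)"
    "frobenius_set r (tl \<alpha>) (tl \<beta>) = insert (b 0) (insert (a m) C)"
    "frobenius_set r (tl \<alpha>) (butlast \<beta>) = insert (b m) (insert (a m) C)"
    "frobenius_set r (butlast \<alpha>) (tl \<beta>) = insert (b 0) (insert (a 0) C)"
    unfolding tls using m ne ord aF by (auto simp: omit C_def)
  have "card ?F = card C + 2"
    unfolding F using ord(3) by (auto simp: C_def)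
  then have "card I = card C + 2"
    using card_frobenius_set[OF dist len(1) bd] I by simp
  then show ?thesis
    unfolding F mid sets
    using minor_pluecker[of C I "b 0" "b m" "a m" "a 0" A] ord aF bF
    by (simp add: C_def algebra_simps)
qed

section \<open>Minors of a unitriangular matrix\<close>

lemma sorted_list_of_set_lessThan: "sorted_list_of_set {..<d} = [0..<d]"
  using sorted_list_of_set_range[of 0 d] by (simp add: atLeast0LessThan)

lemma minor_lessThan_eq_1:
  fixes A :: "nat \<Rightarrow> nat \<Rightarrow> 'a::comm_ring_1"
  assumes "\<And>i j. j < i \<Longrightarrow> A i j = 0" "\<And>i. A i i = 1"
  shows "minor A {..<d} {..<d} = 1"
  unfolding minor_def sorted_list_of_set_lessThan
  by (subst ldet_upper_triangular) (simp_all add: assms)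

text \<open>The rows up to \<open>c\<close> against the columns below \<open>c\<close> and
  \<open>a\<close> form a triangular matrix whose last diagonal entry is \<open>A c a\<close>, the
  others being 1. With \<open>c + 1\<close> rows this will be a value of \<open>h\<close>.\<close>

lemma minor_insert_lessThan:
  fixes A :: "nat \<Rightarrow> nat \<Rightarrow> 'a::comm_ring_1"
  assumes "\<And>i j. j < i \<Longrightarrow> A i j = 0" "\<And>i. A i i = 1" "c \<le> a"
  shows "minor A {..<Suc c} (insert a {..<c}) = A c a"
proof -
  have "sorted_list_of_set (insert a {..<c}) = [0..<c] @ [a]"
    using assms(3) by (simp add: lessThan_atLeast0 sorted_insort_is_snoc)
  then have "minor A {..<Suc c} (insert a {..<c}) = ldet A [0..<Suc c] ([0..<c] @ [a])"
    unfolding minor_def by (simp add: lessThan_atLeast0 del: upt_Suc sorted_list_of_set_lessThan_Suc)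
  also have "\<dots> = (\<Prod>i<Suc c. A ([0..<Suc c] ! i) (([0..<c] @ [a]) ! i))"
    by (subst ldet_upper_triangular) (auto simp: nth_append assms(1) simp del: upt_Suc)
  also have "\<dots> = A c a" by (simp add: nth_append assms(2))
  finally show ?thesis .
qed

text \<open>
  The signed minors form column \<open>d\<close> of the inverse of the leading \<open>r \<times> r\<close> block.
\<close>

lemma sum_signed_minor:
  fixes A :: "nat \<Rightarrow> nat \<Rightarrow> 'a::comm_ring_1"
  assumes A: "\<And>i j. j < i \<Longrightarrow> A i j = 0" "\<And>i. A i i = 1" and "d < r"
  shows "(\<Sum>b<r. A m b * ((-1) ^ (b + d) * (if b \<le> d then minor A {..<d} ({..d} - {b}) else 0)))
    = (if m = d then 1 else 0)"
proof -
  have "(\<Sum>b<r. A m b * ((-1) ^ (b + d) * (if b \<le> d then minor A {..<d} ({..d} - {b}) else 0)))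
      = (\<Sum>b\<le>d. A m b * ((-1) ^ (b + d) * minor A {..<d} ({..d} - {b})))"
    using assms(3) by (intro sum.mono_neutral_cong_right) auto
  also have "\<dots> = (if m = d then 1 else 0)"
  proof (cases m d rule: linorder_cases)
    case less
    have c: "card {x. x \<le> d \<and> x < b} = b" if "b \<le> d" for b
    proof -
      have "{x. x \<le> d \<and> x < b} = {..<b}" using that by auto
      then show ?thesis by simp
    qed
    \<comment> \<open>The sum over \<open>b\<close> is, up to a common sign, the expansion along the
      first row of a determinant in which row \<open>m\<close> occurs twice.\<close>
    have "ldet A (m # sorted_list_of_set {..<d}) (sorted_list_of_set {..d}) = 0"
      using less by (intro ldet_repeated_row) (auto simp del: sorted_list_of_set_atMost_Suc sorted_list_of_set_lessThan_Suc)
    then have "(\<Sum>b\<le>d. (-1) ^ b * A m b * minor A {..<d} ({..d} - {b})) = 0"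
      by (subst (asm) ldet_expand_row_set) (simp_all add: c minor_def)
    then have "(-1) ^ d * (\<Sum>b\<le>d. (-1) ^ b * A m b * minor A {..<d} ({..d} - {b})) = 0" by simp
    then show ?thesis using less by (simp add: sum_distrib_left power_add mult_ac)
  next
    case equal
    have "(\<Sum>b\<le>d. A m b * ((-1) ^ (b + d) * minor A {..<d} ({..d} - {b})))
        = (\<Sum>b\<in>{d}. A m b * ((-1) ^ (b + d) * minor A {..<d} ({..d} - {b})))"
      using equal A(1) by (intro sum.mono_neutral_right) auto
    also have "{..d} - {d} = {..<d}" by auto
    then have "(\<Sum>b\<in>{d}. A m b * ((-1) ^ (b + d) * minor A {..<d} ({..d} - {b}))) = 1"
      using equal A minor_lessThan_eq_1[of A d, OF A] by (simp add: minus_one_power_iff)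
    finally show ?thesis using equal by simp
  next
    case greater
    then show ?thesis using A(1) by (auto intro!: sum.neutral)
  qed
  finally show ?thesis .
qed

lemma minus_one_power_cong: "even (m + n) \<Longrightarrow> (-1 :: 'a::ring_1) ^ m = (-1) ^ n"
  by (simp add: minus_one_power_iff)

text \<open>Part (2) with the values of \<open>h\<close> and \<open>e\<close> still written as
  entries in row \<open>c\<close> and as minors \<open>E\<close>. As integers,
  \<open>d - (r - 1 - \<beta> ! j)\<close> is the index \<open>\<beta> ! j - last \<delta>\<close>
  of the value of \<open>e\<close>. Counting positions from 0 keeps the sign, since \<open>i\<close>
  and \<open>j\<close> shift together.\<close>

lemma minor_skew_recurrence:
  fixes A :: "nat \<Rightarrow> nat \<Rightarrow> 'a::comm_ring_1"
  assumes A: "\<And>i j. j < i \<Longrightarrow> A i j = 0" "\<And>i. A i i = 1"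
    and \<alpha>\<beta>: "sorted_wrt (>) \<alpha>" "sorted_wrt (>) \<beta>" "length \<alpha> = length \<beta>" "\<And>x. x \<in> set \<beta> \<Longrightarrow> x < r"
    and \<gamma>\<delta>: "sorted_wrt (>) \<gamma>" "sorted_wrt (>) \<delta>" "length \<gamma> = length \<delta>" "\<And>x. x \<in> set \<delta> \<Longrightarrow> x < r"
    and ne: "\<alpha> \<noteq> []" "\<gamma> \<noteq> []"
    and c: "c = r + last \<gamma>" and d: "d = r - 1 - last \<delta>"
    and E: "\<And>b. E b = (if b \<le> d then minor A {..<d} ({..d} - {b}) else 0)"
  shows "minor A (frobenius_set r \<gamma> \<delta>) (frobenius_set r \<alpha> \<beta>)
        * minor A (frobenius_set r (butlast \<gamma>) (butlast \<delta>)) (frobenius_set r (tl \<alpha>) (tl \<beta>))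
    = minor A (frobenius_set r (butlast \<gamma>) (butlast \<delta>)) (frobenius_set r \<alpha> \<beta>)
        * minor A (frobenius_set r \<gamma> \<delta>) (frobenius_set r (tl \<alpha>) (tl \<beta>))
      + (\<Sum>i<length \<alpha>. \<Sum>j<length \<alpha>. (-1) ^ (i + j) * A c (r + \<alpha> ! i) * E (r - 1 - \<beta> ! j)
          * minor A (frobenius_set r (butlast \<gamma>) (butlast \<delta>)) (frobenius_set r (omit i \<alpha>) (tl \<beta>))
          * minor A (frobenius_set r (butlast \<gamma>) (butlast \<delta>)) (frobenius_set r (tl \<alpha>) (omit j \<beta>)))"
proof -
  define p q where "p = length \<alpha>" and "q = length \<gamma>"
  define a b where "a i = r + \<alpha> ! i" and "b j = r - 1 - \<beta> ! j" for i j
  define J where "J = frobenius_set r \<alpha> \<beta>"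
  define I where "I = frobenius_set r \<gamma> \<delta>"
  have pq: "0 < p" "length \<beta> = p" "0 < q" "length \<delta> = q" "\<beta> \<noteq> []" "\<delta> \<noteq> []"
    using ne \<alpha>\<beta>(3) \<gamma>\<delta>(3) by (auto simp: p_def q_def)
  note dist = sorted_wrt_greater_distinct[OF \<alpha>\<beta>(1)] sorted_wrt_greater_distinct[OF \<alpha>\<beta>(2)]
    sorted_wrt_greater_distinct[OF \<gamma>\<delta>(1)] sorted_wrt_greater_distinct[OF \<gamma>\<delta>(2)]
  have cn: "c = r + \<gamma> ! (q - 1)" and dn: "d = r - 1 - \<delta> ! (q - 1)"
    using pq ne by (auto simp: c d last_conv_nth q_def)
  have cI: "c \<in> I" using pq by (auto simp: cn I_def q_def intro!: arm_in_frobenius_set)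
  have dI: "d \<notin> I" "d < r"
    unfolding dn I_def using leg_notin_frobenius_set[OF \<gamma>\<delta>(4), where j = "q - 1"] pq by auto
  have aJ: "a i \<in> J" if "i < p" for i
    using that by (auto simp: a_def J_def p_def intro!: arm_in_frobenius_set)
  have bJ: "b j \<notin> J" "b j < r" if "j < p" for j
    unfolding b_def J_def using leg_notin_frobenius_set[OF \<alpha>\<beta>(4), where j = j] that pq by auto
  have fin: "finite I" "finite J" by (simp_all add: I_def J_def)
  have card: "card I = r" "card J = r"
    using dist \<alpha>\<beta>(3,4) \<gamma>\<delta>(3,4) by (auto simp: I_def J_def intro!: card_frobenius_set)
  have dc: "d < c" and rc: "r \<le> c" using dI by (auto simp: c)
  have r: "0 < r" using dI by simp

  have J_omit: "frobenius_set r (omit i \<alpha>) (omit j \<beta>) = insert (b j) (J - {a i})"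
    if "i < p" "j < p" for i j
    unfolding a_def b_def J_def using that dist \<alpha>\<beta>(4) pq by (intro frobenius_set_omit) (auto simp: p_def)
  have I_omit: "frobenius_set r (butlast \<gamma>) (butlast \<delta>) = insert d (I - {c})"
    unfolding cn dn I_def using dist \<gamma>\<delta>(4) pq ne
    by (simp add: butlast_eq_omit frobenius_set_omit q_def)

  define R where "R = I - {c}"
  define C where "C = J - {a 0}"
  let ?Rl = "sorted_list_of_set R" and ?Cl = "sorted_list_of_set C"
  have R: "finite R" "card R + 1 = r" "c \<notin> R" "d \<notin> R" "insert c R = I"
    using fin card cI dI r by (auto simp: R_def)
  have C: "finite C" "card C + 1 = r" "a 0 \<notin> C" "insert (a 0) C = J"
    using fin card aJ pq r by (auto simp: C_def)
  have bC: "b j \<notin> C" if "j < p" for j using bJ that by (auto simp: C_def)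
  \<comment> \<open>The sign of moving \<open>x\<close> to the front of the sorted list of
    \<open>insert x S\<close>, for \<open>x\<close> outside \<open>S\<close>.\<close>
  define sg where "sg S x = ((-1) ^ card {y \<in> S. y < x} :: 'a)" for S and x :: nat
  have sq: "sg S x * sg S x = 1" for S x by (simp add: sg_def flip: power_mult_distrib)
  have sgd: "sg R d = (-1) ^ (d + (q - 1))" and sgc: "sg R c = (-1) ^ (r + q)"
  proof -
    have "{y \<in> R. y < d} = {y \<in> I. y < d}" "{y \<in> R. y < c} = {y \<in> I. y < c}"
      using dc by (auto simp: R_def)
    moreover have "card {y \<in> I. y < d} + (q - 1) = d"
      unfolding dn I_def using card_below_leg[OF \<gamma>\<delta>(2,4), of "q - 1"] pq by simp
    moreover have "card {y \<in> I. y < c} + q = r"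
      unfolding cn I_def using card_below_arm[OF \<gamma>\<delta>, of "q - 1"] pq by (simp add: q_def)
    \<comment> \<open>Sums of exponents are shown to be even, so that no count has to be
      subtracted.\<close>
    ultimately have h: "card {y \<in> R. y < d} + (d + (q - 1)) = 2 * d"
        "card {y \<in> R. y < c} + (r + q) = 2 * r"
      by simp_all
    show "sg R d = (-1) ^ (d + (q - 1))" "sg R c = (-1) ^ (r + q)"
      unfolding sg_def by (rule minus_one_power_cong, unfold h, simp)+
  qed
  have sgb: "sg C (b j) = (-1) ^ (b j + j)" if "j < p" for j
  proof -
    have "{y \<in> C. y < b j} = {y \<in> J. y < b j}"
      using bJ[OF that] by (auto simp: C_def a_def)
    moreover have "card {y \<in> J. y < b j} + j = b j"
      unfolding b_def J_def using card_below_leg[OF \<alpha>\<beta>(2,4), of j] pq that by simp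
    ultimately have h: "card {y \<in> C. y < b j} + (b j + j) = 2 * b j" by simp
    show ?thesis unfolding sg_def by (rule minus_one_power_cong, unfold h, simp)
  qed
  have minor_rows: "minor A (insert x R) K = sg R x * ldet A (x # ?Rl) (sorted_list_of_set K)"
    if "x \<notin> R" "finite K" "card K = r" for x K
    unfolding minor_def sg_def using R that by (intro ldet_insert_row) auto
  have minor_C: "minor A (insert x R) (insert y C) = sg R x * sg C y * ldet A (x # ?Rl) (y # ?Cl)"
    if "x \<notin> R" "y \<notin> C" for x y
  proof -
    have "card (insert y C) = r" using C that by simp
    then have "minor A (insert x R) (insert y C)
        = sg R x * ldet A (x # ?Rl) ([] @ sorted_list_of_set (insert y C))"
      using minor_rows[of x "insert y C"] C(1) that by simp
    also have "\<dots> = sg R x * (sg C y * ldet A (x # ?Rl) ([] @ y # ?Cl))"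
      unfolding sg_def using C R that by (subst ldet_insert_column) auto
    finally show ?thesis by simp
  qed

  define T where "T = ldet A (c # d # ?Rl) (a 0 # b 0 # ?Cl)"
  define M where "M = ldet A ?Rl ?Cl"
  \<comment> \<open>Both products on the left carry the same four insertion signs, so their
    difference is the Desnanot-Jacobi identity times that common factor.\<close>
  have dj: "minor A I J * minor A (insert d R) (insert (b 0) C)
      - minor A (insert d R) J * minor A I (insert (b 0) C)
      = sg R c * sg R d * sg C (a 0) * sg C (b 0) * (T * M)"
  proof -
    have TM: "T * M = ldet A (c # ?Rl) (a 0 # ?Cl) * ldet A (d # ?Rl) (b 0 # ?Cl)
        - ldet A (c # ?Rl) (b 0 # ?Cl) * ldet A (d # ?Rl) (a 0 # ?Cl)"
      unfolding T_def M_def using R C dc by (intro desnanot_jacobi) auto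
    show ?thesis
      unfolding TM using minor_C[of c "a 0"] minor_C[of c "b 0"] minor_C[of d "a 0"] minor_C[of d "b 0"] R C bC pq
      by (simp add: algebra_simps)
  qed

  \<comment> \<open>\<open>P i\<close> drops arm \<open>i\<close> and the first leg,
    \<open>Q j\<close> the first arm and leg \<open>j\<close>; these are the minors in the double
    sum.\<close>
  define P where "P i = minor A (insert d R) (insert (b 0) (J - {a i}))" for i
  define Q where "Q j = minor A (insert d R) (insert (b j) C)" for j
  have Mexp: "M = (-1) ^ (q - 1) * (\<Sum>j<p. (-1) ^ j * E (b j) * Q j)"
  proof -
    \<comment> \<open>Column \<open>d\<close> of the inverse of the leading block expresses the unit
      column of \<open>d\<close> through the columns below \<open>r\<close>.\<close>
    have "M = (\<Sum>x<r. (-1) ^ (x + d) * E x * ldet A (d # ?Rl) (x # ?Cl))"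
      unfolding M_def using R C dI E sum_signed_minor[of A d r, OF A]
      by (intro ldet_unit_column_combination[symmetric]) auto
    \<comment> \<open>A column below \<open>r\<close> that is not the position of a leg already lies
      in \<open>C\<close>, so its term has a repeated column.\<close>
    also have "\<dots> = (\<Sum>x\<in>b ` {..<p}. (-1) ^ (x + d) * E x * ldet A (d # ?Rl) (x # ?Cl))"
    proof (rule sum.mono_neutral_right)
      show "b ` {..<p} \<subseteq> {..<r}" using bJ by auto
      show "\<forall>x\<in>{..<r} - b ` {..<p}. (-1) ^ (x + d) * E x * ldet A (d # ?Rl) (x # ?Cl) = 0"
      proof
        fix x assume x: "x \<in> {..<r} - b ` {..<p}"
        have "set \<beta> = (!) \<beta> ` {..<p}" using pq by (simp add: set_eq_nth_image)
        then have "x \<in> J" using x by (auto simp: J_def frobenius_set_def b_def)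
        then have "x \<in> C" using x by (auto simp: C_def a_def)
        then have "ldet A (d # ?Rl) (x # ?Cl) = 0"
          using R C by (intro ldet_repeated_column) auto
        then show "(-1) ^ (x + d) * E x * ldet A (d # ?Rl) (x # ?Cl) = 0" by simp
      qed
    qed simp
    also have "\<dots> = (\<Sum>j<p. (-1) ^ (b j + d) * E (b j) * ldet A (d # ?Rl) (b j # ?Cl))"
    proof (subst sum.reindex)
      show "inj_on b {..<p}"
      proof (rule inj_onI)
        fix i j assume ij: "i \<in> {..<p}" "j \<in> {..<p}" "b i = b j"
        then have "\<beta> ! i = \<beta> ! j"
          using \<alpha>\<beta>(4)[of "\<beta> ! i"] \<alpha>\<beta>(4)[of "\<beta> ! j"] pq by (simp add: b_def)
        then show "i = j" using ij dist(2) pq by (simp add: nth_eq_iff_index_eq)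
      qed
    qed simp
    also have "\<dots> = (\<Sum>j<p. (-1) ^ (q - 1) * ((-1) ^ j * E (b j) * Q j))"
    proof (rule sum.cong[OF refl])
      fix j assume "j \<in> {..<p}"
      then have j: "j < p" by simp
      have "(-1) ^ (q - 1) * ((-1) ^ j * E (b j) * Q j)
          = ((-1) ^ (q - 1) * (-1) ^ j * sg R d * sg C (b j)) * E (b j) * ldet A (d # ?Rl) (b j # ?Cl)"
        using minor_C[of d "b j"] R bC[OF j] by (simp add: Q_def)
      \<comment> \<open>The exponents \<open>q - 1\<close> and \<open>j\<close> each occur twice and
        cancel, leaving \<open>b j + d\<close>.\<close>
      also have "(-1) ^ (q - 1) * (-1) ^ j * sg R d * sg C (b j) = (-1) ^ (b j + d)"
        unfolding sgd sgb[OF j] by (auto simp: minus_one_power_iff)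
      finally show "(-1) ^ (b j + d) * E (b j) * ldet A (d # ?Rl) (b j # ?Cl)
          = (-1) ^ (q - 1) * ((-1) ^ j * E (b j) * Q j)" by simp
    qed
    finally show ?thesis by (simp add: sum_distrib_left)
  qed

  have Texp: "sg C (a 0) * sg C (b 0) * T = - sg R d * (-1) ^ r * (\<Sum>i<p. (-1) ^ i * A c (a i) * P i)"
  proof -
    let ?K = "insert (b 0) J"
    have b0: "b 0 < a 0" "b 0 \<notin> J" using bJ[of 0] pq by (auto simp: a_def)
    have K: "finite ?K" "card ?K = Suc r" using fin card b0 by auto
    have "ldet A (c # d # ?Rl) ([] @ sorted_list_of_set ?K)
        = sg C (b 0) * ldet A (c # d # ?Rl) ([b 0] @ sorted_list_of_set (insert (a 0) C))"
    proof -
      have "{y \<in> J. y < b 0} = {y \<in> C. y < b 0}" using b0 by (auto simp: C_def)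
      then show ?thesis
        unfolding sg_def C(4) using fin card b0 R by (subst ldet_insert_column) auto
    qed
    also have "\<dots> = sg C (b 0) * (sg C (a 0) * ldet A (c # d # ?Rl) ([b 0] @ a 0 # ?Cl))"
      unfolding sg_def using C R by (subst ldet_insert_column) auto
    \<comment> \<open>The columns come out of \<open>?K\<close> with \<open>b 0\<close> in front of
      \<open>a 0\<close>, whereas \<open>T\<close> has the opposite order; hence the minus
      sign.\<close>
    also have "ldet A (c # d # ?Rl) ([b 0] @ a 0 # ?Cl) = - T"
      unfolding T_def using C R ldet_swap_columns[of "c # d # ?Rl" "[]" ?Cl A "b 0" "a 0"] by simp
    finally have "sg C (a 0) * sg C (b 0) * T = - ldet A (c # d # ?Rl) (sorted_list_of_set ?K)"
      by simp
    also have "ldet A (c # d # ?Rl) (sorted_list_of_set ?K)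
        = (\<Sum>k\<in>?K. sg ?K k * A c k * ldet A (d # ?Rl) (sorted_list_of_set (?K - {k})))"
      unfolding sg_def using K R by (intro ldet_expand_row_set) auto
    \<comment> \<open>As \<open>c \<ge> r\<close>, row \<open>c\<close> vanishes in the columns
      below \<open>r\<close>; the columns of \<open>?K\<close> from \<open>r\<close> on are those of
      the arms.\<close>
    also have "\<dots> = (\<Sum>k\<in>a ` {..<p}. sg ?K k * A c k * ldet A (d # ?Rl) (sorted_list_of_set (?K - {k})))"
    proof (rule sum.mono_neutral_right)
      show "a ` {..<p} \<subseteq> ?K" using aJ by auto
      show "\<forall>k\<in>?K - a ` {..<p}. sg ?K k * A c k * ldet A (d # ?Rl) (sorted_list_of_set (?K - {k})) = 0"
      proof
        fix k assume k: "k \<in> ?K - a ` {..<p}"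
        have "set \<alpha> = (!) \<alpha> ` {..<p}" by (simp add: set_eq_nth_image p_def)
        then have "k < r" using k bJ(2)[OF pq(1)] by (auto simp: J_def frobenius_set_def a_def)
        then have "A c k = 0" using rc by (intro A(1)) simp
        then show "sg ?K k * A c k * ldet A (d # ?Rl) (sorted_list_of_set (?K - {k})) = 0" by simp
      qed
    qed (use fin in simp)
    also have "\<dots> = (\<Sum>i<p. sg ?K (a i) * A c (a i) * ldet A (d # ?Rl) (sorted_list_of_set (?K - {a i})))"
      using dist(1) by (subst sum.reindex) (auto simp: inj_on_def a_def p_def nth_eq_iff_index_eq)
    also have "\<dots> = (\<Sum>i<p. sg R d * (-1) ^ r * ((-1) ^ i * A c (a i) * P i))"
    proof (rule sum.cong[OF refl])
      fix i assume "i \<in> {..<p}"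
      then have i: "i < p" by simp
      have bi: "b 0 < a i" using b0 bJ(2)[OF pq(1)] by (simp add: a_def)
      have Ki: "?K - {a i} = insert (b 0) (J - {a i})" using bi by auto
      have "card (insert (b 0) (J - {a i})) = r"
        using fin card b0 aJ[OF i] r by simp
      then have "sg R d * P i = (sg R d * sg R d) * ldet A (d # ?Rl) (sorted_list_of_set (?K - {a i}))"
        unfolding P_def Ki using minor_rows[of d "insert (b 0) (J - {a i})"] R fin by simp
      then have P: "sg R d * P i = ldet A (d # ?Rl) (sorted_list_of_set (?K - {a i}))"
        by (simp add: sq)
      \<comment> \<open>The additional column \<open>b 0\<close> lies below every arm, so
        \<open>r - i\<close> columns of \<open>?K\<close> precede \<open>a i\<close>, one more than
        in \<open>J\<close>.\<close>
      have "{y \<in> ?K. y < a i} = insert (b 0) {y \<in> J. y < a i}" using bi by auto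
      then have "card {y \<in> ?K. y < a i} = Suc (card {y \<in> J. y < a i})" using fin b0 by simp
      moreover have "card {y \<in> J. y < a i} + Suc i = r"
        unfolding a_def J_def using card_below_arm[OF \<alpha>\<beta>, of i] i by (simp add: p_def)
      ultimately have "card {y \<in> ?K. y < a i} + i = r" by simp
      then have h: "card {y \<in> ?K. y < a i} + (r + i) = 2 * r" by linarith
      have "sg ?K (a i) = (-1) ^ r * (-1) ^ i"
        unfolding sg_def power_add[symmetric] by (rule minus_one_power_cong, unfold h, simp)
      then show "sg ?K (a i) * A c (a i) * ldet A (d # ?Rl) (sorted_list_of_set (?K - {a i}))
          = sg R d * (-1) ^ r * ((-1) ^ i * A c (a i) * P i)"
        unfolding P[symmetric] by (simp add: mult_ac)
    qed
    finally show ?thesis by (simp add: sum_distrib_left sum_negf)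
  qed

  have "sg R c * sg R d * sg C (a 0) * sg C (b 0) * (T * M)
      = sg R c * sg R d * (sg C (a 0) * sg C (b 0) * T) * M" by (simp add: mult_ac)
  also have "\<dots> = (- sg R c * (-1) ^ r * (-1) ^ (q - 1)) * (sg R d * sg R d)
      * ((\<Sum>i<p. (-1) ^ i * A c (a i) * P i) * (\<Sum>j<p. (-1) ^ j * E (b j) * Q j))"
    unfolding Texp Mexp by (simp add: mult_ac)
  \<comment> \<open>By \<open>sgc\<close> the exponents add up to \<open>2 * r + 2 * q - 1\<close>,
    an odd number, which offsets the leading minus.\<close>
  also have "- sg R c * (-1) ^ r * (-1) ^ (q - 1) = 1"
    unfolding sgc using pq(3) by (cases q) (auto simp: minus_one_power_iff)
  also have "(\<Sum>i<p. (-1) ^ i * A c (a i) * P i) * (\<Sum>j<p. (-1) ^ j * E (b j) * Q j)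
      = (\<Sum>i<p. \<Sum>j<p. (-1) ^ (i + j) * A c (a i) * E (b j) * P i * Q j)"
    unfolding sum_product by (intro sum.cong refl) (simp add: power_add mult_ac)
  finally have rhs: "sg R c * sg R d * sg C (a 0) * sg C (b 0) * (T * M)
      = (\<Sum>i<p. \<Sum>j<p. (-1) ^ (i + j) * A c (a i) * E (b j) * P i * Q j)" by (simp add: sq)

  have L: "frobenius_set r (omit i \<alpha>) (tl \<beta>) = insert (b 0) (J - {a i})" if "i < p" for i
    using J_omit[OF that pq(1)] pq by (simp add: tl_eq_omit)
  have L': "frobenius_set r (tl \<alpha>) (omit j \<beta>) = insert (b j) C" if "j < p" for j
    using J_omit[OF pq(1) that] ne by (simp add: tl_eq_omit C_def)
  have "frobenius_set r (tl \<alpha>) (tl \<beta>) = insert (b 0) C"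
    using L'[OF pq(1)] pq by (simp add: tl_eq_omit)
  moreover have "(\<Sum>i<p. \<Sum>j<p. (-1) ^ (i + j) * A c (r + \<alpha> ! i) * E (r - 1 - \<beta> ! j)
          * minor A (insert d R) (frobenius_set r (omit i \<alpha>) (tl \<beta>))
          * minor A (insert d R) (frobenius_set r (tl \<alpha>) (omit j \<beta>)))
      = (\<Sum>i<p. \<Sum>j<p. (-1) ^ (i + j) * A c (a i) * E (b j) * P i * Q j)"
    by (intro sum.cong refl) (simp add: L L' P_def Q_def a_def b_def)
  moreover have "minor A I J * minor A (insert d R) (insert (b 0) C)
      = minor A (insert d R) J * minor A I (insert (b 0) C)
        + (\<Sum>i<p. \<Sum>j<p. (-1) ^ (i + j) * A c (a i) * E (b j) * P i * Q j)"
    unfolding rhs[symmetric] dj[symmetric] by simp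
  ultimately show ?thesis
    unfolding I_omit R_def[symmetric] J_def[symmetric] I_def[symmetric] p_def[symmetric] by simp
qed


section \<open>Minors of the upper factor\<close>

text \<open>Picking at the number of elements below \<open>x\<close> returns \<open>x\<close>, and
  entry \<open>n\<close> of the sorted list has \<open>n\<close> elements below it.\<close>

lemma pick_eq_nth_sorted_list_of_set:
  assumes "finite S" "n < card S"
  shows "pick S n = sorted_list_of_set S ! n"
proof -
  have "sorted_list_of_set S ! n \<in> S"
    using assms nth_mem[of n "sorted_list_of_set S"] by simp
  then show ?thesis
    using pick_card_in_set[of "sorted_list_of_set S ! n" S] assms
    by (simp add: omit_nth_sorted_list_of_set(2))
qed

lemma det_submatrix_eq_minor:
  fixes U :: "'a::comm_ring_1 mat"
  assumes "U \<in> carrier_mat N N" "I \<subseteq> {..<N}" "J \<subseteq> {..<N}" "card I = card J"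
    and "\<And>i j. i < N \<Longrightarrow> j < N \<Longrightarrow> A i j = U $$ (i,j)"
  shows "det (submatrix U I J) = minor A I J"
proof -
  have fin: "finite I" "finite J" using assms(2,3) finite_subset by blast+
  have "{i. i < N \<and> i \<in> I} = I" "{i. i < N \<and> i \<in> J} = J" using assms(2,3) by auto
  moreover have "sorted_list_of_set S ! n < N" if "finite S" "S \<subseteq> {..<N}" "n < card S" for S n
    using that nth_mem[of n "sorted_list_of_set S"] by auto
  ultimately have "submatrix U I J = mat (card I) (card I)
      (\<lambda>(i,j). A (sorted_list_of_set I ! i) (sorted_list_of_set J ! j))"
    using assms fin by (intro eq_matI) (auto simp: submatrix_def pick_eq_nth_sorted_list_of_set)
  then show ?thesis by (simp add: minor_def ldet_def)
qed

section \<open>Frobenius notation in a rectangle\<close>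

text \<open>The condition for \<open>(\<alpha> | \<beta>)\<close> to fit into \<open>r\<close> rows
  of length \<open>s\<close>, stated on the tuples so that it passes to shortened tuples without a
  return to the partition.\<close>

definition frobenius_in :: "nat \<Rightarrow> nat \<Rightarrow> nat list \<Rightarrow> nat list \<Rightarrow> bool" where
  "frobenius_in r s \<alpha> \<beta> \<longleftrightarrow> sorted_wrt (>) \<alpha> \<and> sorted_wrt (>) \<beta> \<and> length \<alpha> = length \<beta> \<and>
     (\<forall>x\<in>set \<alpha>. x < s) \<and> (\<forall>x\<in>set \<beta>. x < r)"

lemma frobenius_in_omit:
  "frobenius_in r s \<alpha> \<beta> \<Longrightarrow> i < length \<alpha> \<Longrightarrow> j < length \<beta> \<Longrightarrow> frobenius_in r s (omit i \<alpha>) (omit j \<beta>)"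
  unfolding frobenius_in_def using sorted_wrt_omit[of "(>)"] set_omit_subset by fastforce

text \<open>Parts decrease weakly while \<open>i + 1\<close> grows, so arms decrease strictly; the
  subtraction is exact because the diagonal boxes are present. Columns give the same for
  legs.\<close>

lemma frobenius_in_arms_legs:
  assumes part: "is_partition lam" and rect: "in_rectangle r s lam"
  shows "frobenius_in r s (arms lam) (legs lam)"
proof -
  note c = less_conj_partition_iff[OF part]
  have d: "i < lam i" if "i < diagonal_length lam" for i
    using that less_diagonal_length_iff[OF part] by simp
  have anti: "lam j \<le> lam i" if "i \<le> j" for i j
    using part that by (simp add: is_partition_def antimono_def)
  have conj_anti: "conj_partition lam j \<le> conj_partition lam i" if "i \<le> j" for i j
    using c[of "conj_partition lam i" j] c[of "conj_partition lam i" i] that by linarith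
  have conj_le: "conj_partition lam j \<le> r" for j
    using c[of r j] rect by (auto simp: in_rectangle_def)
  have "sorted_wrt (>) (arms lam)"
    unfolding sorted_wrt_iff_nth_less
  proof (intro allI impI)
    fix i j assume ij: "i < j" "j < length (arms lam)"
    then show "arms lam ! j < arms lam ! i"
      using anti[of i j] d[of j] by (simp add: arms_def)
  qed
  moreover have "sorted_wrt (>) (legs lam)"
    unfolding sorted_wrt_iff_nth_less
  proof (intro allI impI)
    fix i j assume ij: "i < j" "j < length (legs lam)"
    then have "j < conj_partition lam j" using c[of j j] d[of j] by (simp add: legs_def)
    then show "legs lam ! j < legs lam ! i"
      using conj_anti[of i j] ij by (simp add: legs_def)
  qed
  moreover have "\<forall>x\<in>set (arms lam). x < s"
  proof
    fix x assume "x \<in> set (arms lam)"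
    then obtain i where "i < diagonal_length lam" "x = lam i - Suc i" by (auto simp: arms_def)
    moreover have "lam i \<le> s" using rect by (simp add: in_rectangle_def)
    ultimately show "x < s" using d[of i] by linarith
  qed
  moreover have "\<forall>x\<in>set (legs lam). x < r"
  proof
    fix x assume "x \<in> set (legs lam)"
    then obtain i where i: "i < diagonal_length lam" "x = conj_partition lam i - Suc i"
      by (auto simp: legs_def)
    moreover have "i < conj_partition lam i" using c[of i i] d[OF i(1)] by simp
    ultimately show "x < r" using conj_le[of i] by linarith
  qed
  ultimately show ?thesis by (simp add: frobenius_in_def arms_def legs_def)
qed

lemma frobenius_Nil: "frobenius [] [] = empty_partition"
  by (simp add: fun_eq_iff frobenius_def empty_partition_def)

lemma index_set_empty_partition: "index_set r empty_partition = {..<r}"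
  by (auto simp: index_set_def empty_partition_def)

section \<open>Index sets of one row and of one column\<close>

lemma index_set_row_partition: "index_set (Suc c) (row_partition n) = insert (c + n) {..<c}"
proof (intro Set.set_eqI iffI)
  fix x assume "x \<in> index_set (Suc c) (row_partition n)"
  then show "x \<in> insert (c + n) {..<c}"
    by (auto simp: index_set_def row_partition_def split: if_splits)
next
  fix x assume "x \<in> insert (c + n) {..<c}"
  \<comment> \<open>A value below \<open>c\<close> is its own index; the value \<open>c + n\<close>
    belongs to the last index \<open>c\<close>, which meets the first part.\<close>
  then have "x = row_partition n (c - min x c) + min x c" "min x c < Suc c"
    by (auto simp: row_partition_def)
  then show "x \<in> index_set (Suc c) (row_partition n)" unfolding index_set_def by force
qed

lemma index_set_column_partition:
  assumes "n \<le> d"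
  shows "index_set d (column_partition n) = {..d} - {d - n}"
proof (intro Set.set_eqI iffI)
  fix x assume "x \<in> index_set d (column_partition n)"
  then show "x \<in> {..d} - {d - n}"
    using assms by (auto simp: index_set_def column_partition_def split: if_splits)
next
  fix x assume x: "x \<in> {..d} - {d - n}"
  \<comment> \<open>The unit parts belong to the last \<open>n\<close> indices and shift them up by
    one, which opens the gap at \<open>d - n\<close>.\<close>
  define b where "b = (if x < d - n then x else x - 1)"
  have "x = column_partition n (d - 1 - b) + b" "b < d"
    using x assms by (auto simp: b_def column_partition_def)
  then show "x \<in> index_set d (column_partition n)" unfolding index_set_def by blast
qed

text \<open>
  Outside the matrix, \<open>A\<close> continues as the identity, so that triangularity needs no index bounds.
\<close>

locale unitriangular_gauss =
  fixes N :: nat and X :: "'a::field mat" and A :: "nat \<Rightarrow> nat \<Rightarrow> 'a"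
  assumes carrier: "gauss_upper X \<in> carrier_mat N N"
    and entry: "\<And>i j. i < N \<Longrightarrow> j < N \<Longrightarrow> A i j = gauss_upper X $$ (i,j)"
    and A0: "\<And>i j. j < i \<Longrightarrow> A i j = 0"
    and A1: "\<And>i. A i i = 1"
begin

lemma skewS_eq_minor:
  assumes "index_set r lam \<subseteq> {..<N}" "index_set r mu \<subseteq> {..<N}"
    "card (index_set r mu) = card (index_set r lam)"
  shows "skewS X r lam mu = minor A (index_set r mu) (index_set r lam)"
  unfolding skewS_def using assms carrier entry by (intro det_submatrix_eq_minor) auto

lemma skewS_frobenius:
  assumes "r \<le> N" "frobenius_in r (N - r) \<alpha> \<beta>" "frobenius_in r (N - r) \<gamma> \<delta>"
  shows "skewS X r (frobenius \<alpha> \<beta>) (frobenius \<gamma> \<delta>)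
    = minor A (frobenius_set r \<gamma> \<delta>) (frobenius_set r \<alpha> \<beta>)"
proof -
  have *: "index_set r (frobenius \<alpha> \<beta>) = frobenius_set r \<alpha> \<beta>" "frobenius_set r \<alpha> \<beta> \<subseteq> {..<N}"
    "card (frobenius_set r \<alpha> \<beta>) = r" if "frobenius_in r (N - r) \<alpha> \<beta>" for \<alpha> \<beta>
  proof -
    note f = that[unfolded frobenius_in_def]
    show "index_set r (frobenius \<alpha> \<beta>) = frobenius_set r \<alpha> \<beta>"
      using f by (intro index_set_frobenius) auto
    show "card (frobenius_set r \<alpha> \<beta>) = r"
      using f by (intro card_frobenius_set) (auto intro: sorted_wrt_greater_distinct)
    show "frobenius_set r \<alpha> \<beta> \<subseteq> {..<N}"
      using f assms(1) by (force simp: frobenius_set_def)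
  qed
  show ?thesis
    using skewS_eq_minor[of r "frobenius \<alpha> \<beta>" "frobenius \<gamma> \<delta>"] *[OF assms(2)] *[OF assms(3)] by simp
qed

lemma straightS_frobenius:
  assumes "r \<le> N" "frobenius_in r (N - r) \<alpha> \<beta>"
  shows "straightS X r (frobenius \<alpha> \<beta>) = minor A {..<r} (frobenius_set r \<alpha> \<beta>)"
proof -
  have "frobenius_in r (N - r) [] []" by (simp add: frobenius_in_def)
  then show ?thesis
    using skewS_frobenius[OF assms, of "[]" "[]"]
    by (simp add: straightS_def frobenius_Nil frobenius_set_def)
qed

text \<open>With \<open>c + 1\<close> rows and a single part \<open>a - c\<close>, the columns are
  those below \<open>c\<close> and \<open>a\<close>. For \<open>a < c\<close> the convention that
  \<open>h\<close> vanishes agrees with the zeros below the diagonal.\<close>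

lemma hS_eq_entry:
  assumes "c < N" "a < N"
  shows "hS X (c + 1) (int a - int c) = A c a"
proof (cases "a < c")
  case True
  then show ?thesis by (simp add: hS_def A0)
next
  case False
  then have n: "nat (int a - int c) = a - c" "c + (a - c) = a" by auto
  have "hS X (c + 1) (int a - int c) = skewS X (Suc c) (row_partition (a - c)) empty_partition"
    using False by (simp add: hS_def straightS_def n)
  also have "\<dots> = minor A {..<Suc c} (insert a {..<c})"
    using skewS_eq_minor[of "Suc c" "row_partition (a - c)" empty_partition] assms False
    by (simp add: index_set_row_partition index_set_empty_partition n)
  also have "\<dots> = A c a"
    using False A0 A1 by (intro minor_insert_lessThan) auto
  finally show ?thesis .
qed

text \<open>A column of height \<open>d - b\<close> leaves out exactly \<open>b\<close> among the
  columns up to \<open>d\<close>; for \<open>b > d\<close> the index of \<open>e\<close> is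
  negative.\<close>

lemma eS_eq_minor:
  assumes "d < N"
  shows "eS X d (int d - int b) = (if b \<le> d then minor A {..<d} ({..d} - {b}) else 0)"
proof (cases "b \<le> d")
  case True
  then have n: "nat (int d - int b) = d - b" "d - (d - b) = b" by auto
  have i: "index_set d (column_partition (d - b)) = {..d} - {b}"
    using index_set_column_partition[of "d - b" d] n by simp
  have sub: "{..d} - {b} \<subseteq> {..<N}" "{..<d} \<subseteq> {..<N}" using assms by auto
  have "eS X d (int d - int b) = skewS X d (column_partition (d - b)) empty_partition"
    using True by (simp add: eS_def straightS_def n)
  also have "\<dots> = minor A {..<d} ({..d} - {b})"
    using skewS_eq_minor[of d "column_partition (d - b)" empty_partition] sub True
    by (simp add: i index_set_empty_partition)
  finally show ?thesis using True by simp
qed (simp add: eS_def)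

end

section \<open>The generic matrix\<close>

lemma unitriangular_gauss_generic_matrix: "\<exists>A. unitriangular_gauss N (generic_matrix N) A"
proof -
  let ?U = "gauss_upper (generic_matrix N)"
  obtain L D where g: "gauss_decomposition N (generic_matrix N) L D ?U"
    using gauss_upper_generic_matrix by blast
  note f = gauss_decomposition_factors[OF g]
  have "unitriangular_gauss N (generic_matrix N)
      (\<lambda>i j. if i < N \<and> j < N then ?U $$ (i,j) else if i = j then 1 else 0)"
    using f(3,6,8) by unfold_locales auto
  then show ?thesis by blast
qed

theorem theorem3p5:
  fixes N r :: nat
    and X :: "cpoly fract mat"
    and lam mu :: "nat \<Rightarrow> nat"
    and \<alpha> \<beta> \<gamma> \<delta> :: "nat list"
    and p q :: nat
  assumes "N > 0"
    and "r \<le> N"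
    and "X = generic_matrix N"
    and "is_partition lam"
    and "is_partition mu"
    and "\<forall>i. mu i \<le> lam i"
    and "in_rectangle r (N - r) lam"
    and "\<alpha> = arms lam" and "\<beta> = legs lam" and "p = diagonal_length lam"
    and "\<gamma> = arms mu" and "\<delta> = legs mu" and "q = diagonal_length mu"
  shows
    "(p \<ge> 2 \<longrightarrow>
        straightS X r (frobenius \<alpha> \<beta>)
          * straightS X r (frobenius (tl (butlast \<alpha>)) (tl (butlast \<beta>)))
        = straightS X r (frobenius (butlast \<alpha>) (butlast \<beta>))
            * straightS X r (frobenius (tl \<alpha>) (tl \<beta>))
          - straightS X r (frobenius (tl \<alpha>) (butlast \<beta>))
            * straightS X r (frobenius (butlast \<alpha>) (tl \<beta>)))
     \<and>
     (q \<ge> 1 \<longrightarrow>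
        skewS X r (frobenius \<alpha> \<beta>) (frobenius \<gamma> \<delta>)
          * skewS X r (frobenius (tl \<alpha>) (tl \<beta>)) (frobenius (butlast \<gamma>) (butlast \<delta>))
        = skewS X r (frobenius \<alpha> \<beta>) (frobenius (butlast \<gamma>) (butlast \<delta>))
            * skewS X r (frobenius (tl \<alpha>) (tl \<beta>)) (frobenius \<gamma> \<delta>)
          + (\<Sum>i<p. \<Sum>j<p. (-1) ^ (i + j)
              * hS X (r + last \<gamma> + 1) (int (\<alpha> ! i) - int (last \<gamma>))
              * eS X (r - last \<delta> - 1) (int (\<beta> ! j) - int (last \<delta>))
              * skewS X r (frobenius (omit i \<alpha>) (tl \<beta>))
                          (frobenius (butlast \<gamma>) (butlast \<delta>))
              * skewS X r (frobenius (tl \<alpha>) (omit j \<beta>))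
                          (frobenius (butlast \<gamma>) (butlast \<delta>))))"
proof (intro conjI impI)
  obtain A where "unitriangular_gauss N X A"
    using unitriangular_gauss_generic_matrix assms(3) by blast
  then interpret unitriangular_gauss N X A .
  have "in_rectangle r (N - r) mu"
    using assms(6,7) by (auto simp: in_rectangle_def intro: order_trans) (metis le_zero_eq)
  then have in\<alpha>\<beta>: "frobenius_in r (N - r) \<alpha> \<beta>" and in\<gamma>\<delta>: "frobenius_in r (N - r) \<gamma> \<delta>"
    using assms by (auto intro!: frobenius_in_arms_legs)
  note \<alpha>\<beta> = in\<alpha>\<beta>[unfolded frobenius_in_def] and \<gamma>\<delta> = in\<gamma>\<delta>[unfolded frobenius_in_def]
  have len: "length \<alpha> = p" "length \<beta> = p" "length \<gamma> = q" "length \<delta> = q"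
    using assms by (simp_all add: arms_def legs_def)
  note S = straightS_frobenius[OF assms(2)] skewS_frobenius[OF assms(2)]
  {
    assume p: "p \<ge> 2"
    have ne: "xs \<noteq> []" "butlast xs \<noteq> []" if "length xs = p" for xs :: "nat list"
      using that p by (cases xs rule: rev_cases; auto)+
    note ne = ne[OF len(1)] ne[OF len(2)]
    note ne = ne(1,3,2,4)
    have in1: "frobenius_in r (N - r) (butlast \<alpha>) (butlast \<beta>)"
      "frobenius_in r (N - r) (tl \<alpha>) (tl \<beta>)"
      "frobenius_in r (N - r) (tl \<alpha>) (butlast \<beta>)"
      "frobenius_in r (N - r) (butlast \<alpha>) (tl \<beta>)"
      unfolding tl_eq_omit[OF ne(1)] tl_eq_omit[OF ne(2)] butlast_eq_omit[OF ne(1)] butlast_eq_omit[OF ne(2)]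
      using p len by (auto intro!: frobenius_in_omit in\<alpha>\<beta>)
    have in2: "frobenius_in r (N - r) (tl (butlast \<alpha>)) (tl (butlast \<beta>))"
      unfolding tl_eq_omit[OF ne(3)] tl_eq_omit[OF ne(4)]
      using ne by (auto intro!: frobenius_in_omit in1)
    show "straightS X r (frobenius \<alpha> \<beta>)
          * straightS X r (frobenius (tl (butlast \<alpha>)) (tl (butlast \<beta>)))
        = straightS X r (frobenius (butlast \<alpha>) (butlast \<beta>))
            * straightS X r (frobenius (tl \<alpha>) (tl \<beta>))
          - straightS X r (frobenius (tl \<alpha>) (butlast \<beta>))
            * straightS X r (frobenius (butlast \<alpha>) (tl \<beta>))"
      unfolding S(1)[OF in\<alpha>\<beta>] S(1)[OF in2] in1[THEN S(1)]
      using \<alpha>\<beta> len p by (intro minor_giambelli_recurrence) auto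
  next
    assume q: "q \<ge> 1"
    \<comment> \<open>\<open>mu\<close> contains the first diagonal box, hence so does
      \<open>lam\<close>, and its tuples are nonempty too.\<close>
    have "0 < mu 0"
      using q assms(5,13) less_diagonal_length_iff[of mu 0] by simp
    then have "0 < lam 0" using assms(6) by (metis not_less le_zero_eq gr0I)
    then have p: "0 < p" using less_diagonal_length_iff[of lam 0] assms(4,10) by simp
    have ne: "\<alpha> \<noteq> []" "\<beta> \<noteq> []" "\<gamma> \<noteq> []" "\<delta> \<noteq> []" using p q len by auto
    have in1: "frobenius_in r (N - r) (tl \<alpha>) (tl \<beta>)"
      "frobenius_in r (N - r) (butlast \<gamma>) (butlast \<delta>)"
      unfolding tl_eq_omit[OF ne(1)] tl_eq_omit[OF ne(2)] butlast_eq_omit[OF ne(3)] butlast_eq_omit[OF ne(4)]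
      using p q len by (auto intro!: frobenius_in_omit in\<alpha>\<beta> in\<gamma>\<delta>)
    have in2: "frobenius_in r (N - r) (omit i \<alpha>) (tl \<beta>)" "frobenius_in r (N - r) (tl \<alpha>) (omit i \<beta>)"
      if "i < p" for i
      unfolding tl_eq_omit[OF ne(1)] tl_eq_omit[OF ne(2)]
      using that p len by (auto intro!: frobenius_in_omit in\<alpha>\<beta>)
    have last: "last \<gamma> < N - r" "last \<delta> < r" using \<gamma>\<delta> ne by auto
    define c d where "c = r + last \<gamma>" and "d = r - 1 - last \<delta>"
    \<comment> \<open>The bounds of the rectangle put rows \<open>c\<close> and \<open>d\<close>
      inside the matrix, as the formulas for \<open>h\<close> and \<open>e\<close> require.\<close>
    have cd: "c < N" "d < N" "r - last \<delta> - 1 = d" using last assms(2) by (auto simp: c_def d_def)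
    define E where "E b = (if b \<le> d then minor A {..<d} ({..d} - {b}) else 0)" for b
    have h: "hS X (r + last \<gamma> + 1) (int (\<alpha> ! i) - int (last \<gamma>)) = A c (r + \<alpha> ! i)" if "i < p" for i
    proof -
      have "\<alpha> ! i < N - r" using \<alpha>\<beta> that len by simp
      then show ?thesis using hS_eq_entry[of c "r + \<alpha> ! i"] cd by (simp add: c_def)
    qed
    have e: "eS X (r - last \<delta> - 1) (int (\<beta> ! j) - int (last \<delta>)) = E (r - 1 - \<beta> ! j)" if "j < p" for j
    proof -
      have "\<beta> ! j < r" using \<alpha>\<beta> that len by simp
      \<comment> \<open>The two offsets \<open>r - 1\<close> cancel.\<close>
      then have "int (\<beta> ! j) - int (last \<delta>) = int d - int (r - 1 - \<beta> ! j)"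
        using last by (simp add: d_def)
      then show ?thesis unfolding cd(3) E_def using eS_eq_minor[OF cd(2)] by simp
    qed
    have "minor A (frobenius_set r \<gamma> \<delta>) (frobenius_set r \<alpha> \<beta>)
        * minor A (frobenius_set r (butlast \<gamma>) (butlast \<delta>)) (frobenius_set r (tl \<alpha>) (tl \<beta>))
      = minor A (frobenius_set r (butlast \<gamma>) (butlast \<delta>)) (frobenius_set r \<alpha> \<beta>)
        * minor A (frobenius_set r \<gamma> \<delta>) (frobenius_set r (tl \<alpha>) (tl \<beta>))
      + (\<Sum>i<length \<alpha>. \<Sum>j<length \<alpha>. (-1) ^ (i + j) * A c (r + \<alpha> ! i) * E (r - 1 - \<beta> ! j)
          * minor A (frobenius_set r (butlast \<gamma>) (butlast \<delta>)) (frobenius_set r (omit i \<alpha>) (tl \<beta>))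
          * minor A (frobenius_set r (butlast \<gamma>) (butlast \<delta>)) (frobenius_set r (tl \<alpha>) (omit j \<beta>)))"
      using \<alpha>\<beta> \<gamma>\<delta> ne A0 A1 by (intro minor_skew_recurrence[where d = d]) (auto simp: c_def d_def E_def)
    moreover have "(\<Sum>i<p. \<Sum>j<p. (-1) ^ (i + j)
              * hS X (r + last \<gamma> + 1) (int (\<alpha> ! i) - int (last \<gamma>))
              * eS X (r - last \<delta> - 1) (int (\<beta> ! j) - int (last \<delta>))
              * skewS X r (frobenius (omit i \<alpha>) (tl \<beta>)) (frobenius (butlast \<gamma>) (butlast \<delta>))
              * skewS X r (frobenius (tl \<alpha>) (omit j \<beta>)) (frobenius (butlast \<gamma>) (butlast \<delta>)))
      = (\<Sum>i<p. \<Sum>j<p. (-1) ^ (i + j) * A c (r + \<alpha> ! i) * E (r - 1 - \<beta> ! j)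
          * minor A (frobenius_set r (butlast \<gamma>) (butlast \<delta>)) (frobenius_set r (omit i \<alpha>) (tl \<beta>))
          * minor A (frobenius_set r (butlast \<gamma>) (butlast \<delta>)) (frobenius_set r (tl \<alpha>) (omit j \<beta>)))"
    proof (intro sum.cong refl)
      fix i j assume "i \<in> {..<p}" "j \<in> {..<p}"
      then have ij: "i < p" "j < p" by simp_all
      show "(-1) ^ (i + j)
              * hS X (r + last \<gamma> + 1) (int (\<alpha> ! i) - int (last \<gamma>))
              * eS X (r - last \<delta> - 1) (int (\<beta> ! j) - int (last \<delta>))
              * skewS X r (frobenius (omit i \<alpha>) (tl \<beta>)) (frobenius (butlast \<gamma>) (butlast \<delta>))
              * skewS X r (frobenius (tl \<alpha>) (omit j \<beta>)) (frobenius (butlast \<gamma>) (butlast \<delta>))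
          = (-1) ^ (i + j) * A c (r + \<alpha> ! i) * E (r - 1 - \<beta> ! j)
          * minor A (frobenius_set r (butlast \<gamma>) (butlast \<delta>)) (frobenius_set r (omit i \<alpha>) (tl \<beta>))
          * minor A (frobenius_set r (butlast \<gamma>) (butlast \<delta>)) (frobenius_set r (tl \<alpha>) (omit j \<beta>))"
        unfolding h[OF ij(1)] e[OF ij(2)] S(2)[OF in2(1)[OF ij(1)] in1(2)]
          S(2)[OF in2(2)[OF ij(2)] in1(2)] by simp
    qed
    ultimately show "skewS X r (frobenius \<alpha> \<beta>) (frobenius \<gamma> \<delta>)
          * skewS X r (frobenius (tl \<alpha>) (tl \<beta>)) (frobenius (butlast \<gamma>) (butlast \<delta>))
        = skewS X r (frobenius \<alpha> \<beta>) (frobenius (butlast \<gamma>) (butlast \<delta>))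
            * skewS X r (frobenius (tl \<alpha>) (tl \<beta>)) (frobenius \<gamma> \<delta>)
          + (\<Sum>i<p. \<Sum>j<p. (-1) ^ (i + j)
              * hS X (r + last \<gamma> + 1) (int (\<alpha> ! i) - int (last \<gamma>))
              * eS X (r - last \<delta> - 1) (int (\<beta> ! j) - int (last \<delta>))
              * skewS X r (frobenius (omit i \<alpha>) (tl \<beta>))
                          (frobenius (butlast \<gamma>) (butlast \<delta>))
              * skewS X r (frobenius (tl \<alpha>) (omit j \<beta>))
                          (frobenius (butlast \<gamma>) (butlast \<delta>)))"
      unfolding S(2)[OF in\<alpha>\<beta> in\<gamma>\<delta>] S(2)[OF in\<alpha>\<beta> in1(2)] S(2)[OF in1(1) in\<gamma>\<delta>]
        S(2)[OF in1] len(1) by simp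
  }
qed

end
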